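(* Let $n\ge k\ge t\ge1$ be integers. Let $\varepsilon\in(0,0.01]$, $\theta\in(0,1]$, $r>1$ and $q\ge t$ satisfy $$r\ge\max\{2^{15}\log k,\ 2^{17}q\log q,\ q/(\varepsilon\theta)\}.$$ Let $\mathcal{A}\subset\binom{[n]}{k}$ be a $(t,q,\varepsilon,\theta)$-regular and $(r,2q)$-spread family, and let $\mathcal{F}\subset\mathcal{A}$ satisfy $|F\cap F'|\ne t-1$ for all $F,F'\in\mathcal{F}$. Then there exists a $t$-element set $T\subset[n]$ such that either $$|\mathcal{F}\setminus\mathcal{A}[T]|\le e^{-\varepsilon\theta q/t}|\mathcal{A}|,$$ or $$|\mathcal{F}|\le e^{-\varepsilon\theta q/t}|\mathcal{A}|+\frac{2^{17}q\log q}{r}|\mathcal{A}(T)|.$$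
   Context: For a family $\mathcal{G}$ and a set $S$, $\mathcal{G}(S)=\{A\setminus S: A\in\mathcal{G},\ S\subset A\}$; $\mathcal{A}[T]$ denotes the family of members of $\mathcal{A}$ containing $T$ (so $|\mathcal{A}[T]|=|\mathcal{A}(T)|$). A family $\mathcal{G}$ is $r$-spread if $|\mathcal{G}(X)|\le r^{-|X|}|\mathcal{G}|$ for every set $X$; $\mathcal{A}$ is $(r,p)$-spread if $\mathcal{A}(S)$ is $r$-spread for every $S\subset[n]$ with $|S|\le p$. For a family $\mathcal{G}$ and $l\ge0$, the $l$-th shadow is $\partial_l\mathcal{G}=\bigcup_{X\in\mathcal{G}}\binom{X}{l}$, and $\partial_{\le q}\mathcal{G}=\bigcup_{i=0}^q\partial_i\mathcal{G}$. A family $\mathcal{A}\subset\binom{[n]}{k}$ is $(t,q,\varepsilon,\theta)$-regular if for every $l\le t$ and every $S\in\partial_{\le q}\mathcal{A}$: (i) $|\partial_l(\mathcal{A}(S))|\ge(1-\varepsilon)|\partial_l(\mathcal{A})|$; (ii) if $\underline{H}$ is a uniformly random element of $\partial_l(\mathcal{A}(S))$, then $\mathsf{P}\big(|\mathcal{A}(S\cup\underline{H})|\ge\theta\,\mathsf{E}|\mathcal{A}(S\cup\underline{H})|\big)\ge1-\varepsilon$. *)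

theory Defs
  imports "HOL-Probability.Probability" "HOL-Library.Ramsey"
begin

definition link :: "'a set set \<Rightarrow> 'a set \<Rightarrow> 'a set set" where
  "link \<G> S = {A - S | A. A \<in> \<G> \<and> S \<subseteq> A}"

definition containing :: "'a set set \<Rightarrow> 'a set \<Rightarrow> 'a set set" where
  "containing \<G> T = {A \<in> \<G>. T \<subseteq> A}"

definition spread :: "real \<Rightarrow> 'a set set \<Rightarrow> bool" where
  "spread r \<G> \<longleftrightarrow>
     (\<forall>X. real (card (link \<G> X)) \<le> r powr (- real (card X)) * real (card \<G>))"

definition link_spread :: "'a set \<Rightarrow> real \<Rightarrow> nat \<Rightarrow> 'a set set \<Rightarrow> bool" where
  "link_spread V r p \<A> \<longleftrightarrow> (\<forall>S. S \<subseteq> V \<and> card S \<le> p \<longrightarrow> spread r (link \<A> S))"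

definition shadow :: "nat \<Rightarrow> 'a set set \<Rightarrow> 'a set set" where
  "shadow l \<G> = (\<Union>X\<in>\<G>. nsets X l)"

definition shadow_upto :: "nat \<Rightarrow> 'a set set \<Rightarrow> 'a set set" where
  "shadow_upto q \<G> = (\<Union>i\<in>{0..q}. shadow i \<G>)"

(* If the shadow of the link is empty, pmf_of_set is unspecified.  For a nonempty k-uniform
   family with l \<le> t \<le> k and \<epsilon> < 1 this cannot occur, because the first conjunct then fails. *)
definition regular_family :: "nat \<Rightarrow> nat \<Rightarrow> real \<Rightarrow> real \<Rightarrow> 'a set set \<Rightarrow> bool" where
  "regular_family t q \<epsilon> \<theta> \<A> \<longleftrightarrow>
     (\<forall>l\<le>t. \<forall>S\<in>shadow_upto q \<A>.
        real (card (shadow l (link \<A> S))) \<ge> (1 - \<epsilon>) * real (card (shadow l \<A>)) \<and>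
        (let P = pmf_of_set (shadow l (link \<A> S));
             d = (\<lambda>H. real (card (link \<A> (S \<union> H))))
         in measure_pmf.prob P {H. d H \<ge> \<theta> * measure_pmf.expectation P d} \<ge> 1 - \<epsilon>))"

end

theory Submission
  imports Defs
begin

text \<open>
  Put \<open>\<tau> = exp (\<epsilon> * \<theta> / t)\<close>. Peeling off maximal density increments by powers of \<open>\<tau>\<close> covers
  \<open>\<F>\<close>, up to \<open>card \<A> / \<tau> ^ q\<close> sets, by families \<open>\<G>\<^sub>S\<close> of supersets of sets \<open>S\<close> of size at most
  \<open>q\<close>, where the density of \<open>\<G>\<^sub>S\<close> in \<open>\<A>[S \<union> X]\<close> exceeds that in \<open>\<A>[S]\<close> at most by the factor
  \<open>\<tau> ^ card X\<close>.

  Any two supports satisfy \<open>card (S \<inter> S') \<ge> t\<close>. Otherwise let \<open>l = t - 1 - card (S \<inter> S')\<close>. As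
  \<open>\<tau> ^ l\<close> is close to 1, regularity shows that for most \<open>l\<close>-sets \<open>H\<close> of the shadow both families
  keep half of their density above \<open>S \<union> H\<close> and \<open>S' \<union> H\<close>, so that the links there are spread.
  Two spread families contain disjoint members: for a uniformly random \<open>W\<close>, with probability more
  than one half \<open>W\<close> contains a member of the first, and likewise its complement one of the second. This
  gives two members of \<open>\<F>\<close> meeting in the \<open>t - 1\<close> elements of \<open>(S \<inter> S') \<union> H\<close>.

  If all supports contain a common \<open>t\<close>-set, the first alternative holds. Otherwise shrink the
  supports as long as they stay \<open>t\<close>-intersecting, discard those of the largest size \<open>m = t + d\<close>,
  and repeat with smaller \<open>m\<close>. A branching argument shows that each time at most \<open>(6 * m) ^ d\<close> sets
  are discarded, while each has degree at most \<open>r\<close> to the power \<open>- d\<close> times the largest degree of a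
  \<open>t\<close>-set.
\<close>

subsection \<open>Disjoint members of spread families\<close>

text \<open>The expectation of \<open>f W\<close> when \<open>W\<close> contains each element of
  \<open>V\<close> independently with probability \<open>p\<close>. As an explicit finite sum it
  admits induction on \<open>V\<close> through \<open>bern_avg_insert\<close>.\<close>

definition bern_avg :: "real \<Rightarrow> 'a set \<Rightarrow> ('a set \<Rightarrow> real) \<Rightarrow> real" where
  "bern_avg p V f = (\<Sum>W\<in>Pow V. p ^ card W * (1 - p) ^ card (V - W) * f W)"

lemma bern_avg_insert:
  assumes "finite V" "x \<notin> V"
  shows "bern_avg p (insert x V) f =
    (1 - p) * bern_avg p V f + p * bern_avg p V (\<lambda>W. f (insert x W))"
proof -
  let ?g = "\<lambda>W. p ^ card W * (1 - p) ^ card (insert x V - W) * f W"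
  have disj: "Pow V \<inter> insert x ` Pow V = {}" using assms by auto
  have inj: "inj_on (insert x) (Pow V)"
    using assms by (auto simp: inj_on_def insert_ident subset_iff)
  have "bern_avg p (insert x V) f = sum ?g (Pow V) + sum ?g (insert x ` Pow V)"
    unfolding bern_avg_def Pow_insert using assms disj by (intro sum.union_disjoint) auto
  also have "sum ?g (insert x ` Pow V) = (\<Sum>W\<in>Pow V. ?g (insert x W))"
    using inj by (simp add: sum.reindex)
  also have "\<dots> = (\<Sum>W\<in>Pow V. p * (p ^ card W * (1 - p) ^ card (V - W) * f (insert x W)))"
  proof (rule sum.cong[OF refl])
    fix W assume "W \<in> Pow V"
    then have W: "finite W" "x \<notin> W" using assms finite_subset by auto
    have "insert x V - insert x W = V - W" using assms W by auto
    then show "?g (insert x W) = p * (p ^ card W * (1 - p) ^ card (V - W) * f (insert x W))"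
      using W by simp
  qed
  also have "sum ?g (Pow V) = (\<Sum>W\<in>Pow V. (1 - p) * (p ^ card W * (1 - p) ^ card (V - W) * f W))"
  proof (rule sum.cong[OF refl])
    fix W assume W: "W \<in> Pow V"
    then have "insert x V - W = insert x (V - W)" using assms by auto
    then show "?g W = (1 - p) * (p ^ card W * (1 - p) ^ card (V - W) * f W)"
      using assms W by simp
  qed
  finally show ?thesis by (simp add: bern_avg_def sum_distrib_left)
qed

lemma bern_avg_linear:
  "bern_avg p V (\<lambda>W. a * f W + b * g W) = a * bern_avg p V f + b * bern_avg p V g"
  by (simp add: bern_avg_def sum.distrib sum_distrib_left algebra_simps)

lemma bern_avg_const: "finite V \<Longrightarrow> bern_avg p V (\<lambda>_. c) = c"
proof (induction V rule: finite_induct)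
  case empty
  show ?case by (simp add: bern_avg_def)
next
  case (insert x V)
  then show ?case by (simp add: bern_avg_insert algebra_simps)
qed

lemma bern_avg_mono:
  assumes "0 \<le> p" "p \<le> 1" "\<And>W. W \<subseteq> V \<Longrightarrow> f W \<le> g W"
  shows "bern_avg p V f \<le> bern_avg p V g"
  unfolding bern_avg_def using assms by (intro sum_mono mult_left_mono) auto

text \<open>An element is missed by the union of two independent random sets exactly when both miss
  it. The induction keeps \<open>f\<close> arbitrary because adding \<open>x\<close> to
  \<open>V\<close> also calls for the function \<open>f (insert x W)\<close>.\<close>

lemma bern_avg_Un:
  assumes "finite V"
  shows "bern_avg p V (\<lambda>A. bern_avg q V (\<lambda>B. f (A \<union> B))) = bern_avg (1 - (1 - p) * (1 - q)) V f"
  using assms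
proof (induction V arbitrary: f rule: finite_induct)
  case empty
  show ?case by (simp add: bern_avg_def)
next
  case (insert x V)
  let ?g = "\<lambda>W. f (insert x W)"
  have IH: "bern_avg p V (\<lambda>A. bern_avg q V (\<lambda>B. f (A \<union> B))) = bern_avg (1 - (1 - p) * (1 - q)) V f" for f
    by (rule insert.IH)
  have IH': "bern_avg p V (\<lambda>A. bern_avg q V (\<lambda>B. ?g (A \<union> B))) = bern_avg (1 - (1 - p) * (1 - q)) V ?g"
    by (rule insert.IH)
  have "bern_avg p (insert x V) (\<lambda>A. bern_avg q (insert x V) (\<lambda>B. f (A \<union> B)))
      = (1 - p) * bern_avg p V (\<lambda>A. (1 - q) * bern_avg q V (\<lambda>B. f (A \<union> B)) + q * bern_avg q V (\<lambda>B. ?g (A \<union> B)))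
        + p * bern_avg p V (\<lambda>A. bern_avg q V (\<lambda>B. ?g (A \<union> B)))"
    using insert.hyps by (simp add: bern_avg_insert left_diff_distrib)
  also have "\<dots> = bern_avg (1 - (1 - p) * (1 - q)) (insert x V) f"
    using insert.hyps unfolding bern_avg_linear IH IH'
    by (simp add: bern_avg_insert algebra_simps)
  finally show ?case .
qed

text \<open>Among the members that fit into \<open>W\<close> together with \<open>\<phi> i\<close>,
  one with the least remainder outside \<open>W\<close> is chosen, and that remainder is the
  fragment. Members are indexed so that coinciding fragments of different members still count
  separately.\<close>

definition fragment :: "('i \<Rightarrow> 'a set) \<Rightarrow> 'i set \<Rightarrow> 'a set \<Rightarrow> 'i \<Rightarrow> 'a set" where
  "fragment \<phi> I W i =
     \<phi> (arg_min_on (\<lambda>j. card (\<phi> j - W)) {j \<in> I. \<phi> j \<subseteq> W \<union> \<phi> i}) - W"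

lemma fragment:
  assumes "finite I" "i \<in> I"
  obtains j where "j \<in> I" "\<phi> j \<subseteq> W \<union> \<phi> i" "fragment \<phi> I W i = \<phi> j - W"
    "\<And>j'. j' \<in> I \<Longrightarrow> \<phi> j' \<subseteq> W \<union> \<phi> i \<Longrightarrow> card (\<phi> j - W) \<le> card (\<phi> j' - W)"
proof -
  let ?S = "{j \<in> I. \<phi> j \<subseteq> W \<union> \<phi> i}"
  let ?j = "arg_min_on (\<lambda>j. card (\<phi> j - W)) ?S"
  have S: "finite ?S" "?S \<noteq> {}" using assms by auto
  have "?j \<in> ?S" by (rule arg_min_if_finite(1)[OF S])
  moreover have "card (\<phi> ?j - W) \<le> card (\<phi> j' - W)" if "j' \<in> ?S" for j'
    by (rule arg_min_least[OF S that])
  ultimately show ?thesis using that[of ?j] by (auto simp: fragment_def)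
qed

lemma fragment_subset: "finite I \<Longrightarrow> i \<in> I \<Longrightarrow> fragment \<phi> I W i \<subseteq> \<phi> i - W"
  by (erule (1) fragment[of I i \<phi> W]) auto

text \<open>The member \<open>\<phi> l\<close> competes in the minimum defining the fragment. Its
  remainder outside \<open>W\<close> lies in the fragment and cannot be smaller, so the two are
  equal.\<close>

lemma fragment_subset_member:
  assumes "finite I" "i \<in> I" "\<And>j. j \<in> I \<Longrightarrow> finite (\<phi> j)"
    and "l \<in> I" "\<phi> l \<subseteq> W \<union> fragment \<phi> I W i"
  shows "fragment \<phi> I W i \<subseteq> \<phi> l"
proof -
  obtain j where j: "j \<in> I" "fragment \<phi> I W i = \<phi> j - W"
    "\<And>j'. j' \<in> I \<Longrightarrow> \<phi> j' \<subseteq> W \<union> \<phi> i \<Longrightarrow> card (\<phi> j - W) \<le> card (\<phi> j' - W)"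
    using assms fragment by metis
  have "\<phi> l \<subseteq> W \<union> \<phi> i" using assms fragment_subset[of I i \<phi> W] by blast
  then have "card (fragment \<phi> I W i) \<le> card (\<phi> l - W)" using j assms by simp
  moreover have "\<phi> l - W \<subseteq> fragment \<phi> I W i" using assms by auto
  moreover have "finite (fragment \<phi> I W i)" using j assms by simp
  ultimately have "\<phi> l - W = fragment \<phi> I W i" by (metis card_seteq)
  then show ?thesis by auto
qed

text \<open>A fragment \<open>T\<close> and the set \<open>W\<close> are recovered from \<open>Z = W \<union> T\<close> and a choice of
  \<open>T\<close> as a subset of one fixed member contained in \<open>Z\<close>, which leaves few possibilities for \<open>T\<close>.\<close>

lemma bern_avg_large_fragments:
  fixes \<phi> :: "'i \<Rightarrow> 'a set" and M p R :: real
  assumes V: "finite V" and p: "0 < p" "p < 1" and R: "0 < R" "1 \<le> p * R" and M: "0 \<le> M"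
    and I: "finite I" "\<And>i. i \<in> I \<Longrightarrow> \<phi> i \<subseteq> V" "\<And>i. i \<in> I \<Longrightarrow> card (\<phi> i) \<le> 2 * m"
    and sp: "\<And>X. X \<subseteq> V \<Longrightarrow> real (card {i \<in> I. X \<subseteq> \<phi> i}) \<le> M / R ^ card X"
  shows "bern_avg p V (\<lambda>W. real (card {i \<in> I. m \<le> card (fragment \<phi> I W i)})) \<le> M * (4 / (p * R)) ^ m"
proof -
  define \<mu> where "\<mu> W = p ^ card W * (1 - p) ^ card (V - W)" for W
  define \<T> where "\<T> W = {T \<in> fragment \<phi> I W ` I. m \<le> card T}" for W
  define U where "U Z = (if \<exists>i\<in>I. \<phi> i \<subseteq> Z then Pow (\<phi> (SOME i. i \<in> I \<and> \<phi> i \<subseteq> Z)) else {})" for Z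
  have \<mu>0: "0 \<le> \<mu> W" for W using p by (simp add: \<mu>_def)
  have finphi: "finite (\<phi> i)" if "i \<in> I" for i using I V that finite_subset by blast
  have frV: "T \<subseteq> V - W" if "T \<in> \<T> W" for T W
    using that fragment_subset[OF I(1), of _ \<phi> W] I(2) by (fastforce simp: \<T>_def)
  have finT: "finite (\<T> W)" for W using I by (simp add: \<T>_def)
  have 1: "real (card {i \<in> I. m \<le> card (fragment \<phi> I W i)}) \<le> (\<Sum>T\<in>\<T> W. M / R ^ card T)" for W
  proof -
    have sub: "{i \<in> I. m \<le> card (fragment \<phi> I W i)} \<subseteq> (\<Union>T\<in>\<T> W. {i \<in> I. T \<subseteq> \<phi> i})"
      using fragment_subset[OF I(1), of _ \<phi> W] by (auto simp: \<T>_def)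
    have "card {i \<in> I. m \<le> card (fragment \<phi> I W i)} \<le> card (\<Union>T\<in>\<T> W. {i \<in> I. T \<subseteq> \<phi> i})"
      using sub finT I by (intro card_mono) auto
    also have "\<dots> \<le> (\<Sum>T\<in>\<T> W. card {i \<in> I. T \<subseteq> \<phi> i})"
      by (rule card_UN_le[OF finT])
    finally have "real (card {i \<in> I. m \<le> card (fragment \<phi> I W i)})
        \<le> real (\<Sum>T\<in>\<T> W. card {i \<in> I. T \<subseteq> \<phi> i})"
      by (simp only: of_nat_le_iff)
    also have "\<dots> = (\<Sum>T\<in>\<T> W. real (card {i \<in> I. T \<subseteq> \<phi> i}))"
      by (simp only: of_nat_sum)
    also have "\<dots> \<le> (\<Sum>T\<in>\<T> W. M / R ^ card T)"
      using frV by (intro sum_mono sp) auto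
    finally show ?thesis .
  qed
  \<comment> \<open>Moving \<open>T\<close> into \<open>W\<close> trades \<open>card T\<close>
    factors \<open>1 - p\<close> for factors \<open>p\<close>, which costs at most
    \<open>1 / p ^ card T\<close>. Since \<open>p * R\<close> is at least 1, the exponent may be
    lowered from \<open>card T\<close> to \<open>m\<close>.\<close>
  have 2: "\<mu> W * (M / R ^ card T) \<le> \<mu> (W \<union> T) * (M * (1 / (p * R)) ^ m)"
    if "W \<subseteq> V" "T \<in> \<T> W" for W T
  proof -
    have TV: "T \<subseteq> V - W" and mT: "m \<le> card T" using frV that by (auto simp: \<T>_def)
    have fin: "finite T" "finite W" using TV that V by (meson finite_Diff finite_subset)+
    have "card (W \<union> T) = card W + card T" using fin TV by (intro card_Un_disjoint) auto
    moreover have "card (V - W) = card (V - (W \<union> T)) + card T"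
    proof -
      have "V - W = (V - (W \<union> T)) \<union> T" using TV by auto
      then have "card (V - W) = card ((V - (W \<union> T)) \<union> T)" by (rule arg_cong)
      also have "\<dots> = card (V - (W \<union> T)) + card T"
        by (rule card_Un_disjoint) (use V fin in auto)
      finally show ?thesis .
    qed
    ultimately have "\<mu> W * p ^ card T = \<mu> (W \<union> T) * (1 - p) ^ card T"
      by (simp add: \<mu>_def power_add)
    also have "\<dots> \<le> \<mu> (W \<union> T)"
      using p \<mu>0 by (simp add: mult_left_le power_le_one)
    finally have "\<mu> W \<le> \<mu> (W \<union> T) / p ^ card T" using p by (simp add: field_simps)
    then have "\<mu> W * (M / R ^ card T) \<le> \<mu> (W \<union> T) / p ^ card T * (M / R ^ card T)"
      using M R by (intro mult_right_mono) auto
    also have "\<dots> = \<mu> (W \<union> T) * (M * (1 / (p * R)) ^ card T)"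
      by (simp add: power_divide power_mult_distrib)
    also have "\<dots> \<le> \<mu> (W \<union> T) * (M * (1 / (p * R)) ^ m)"
      using \<mu>0 M R mT by (intro mult_left_mono power_decreasing) auto
    finally show ?thesis .
  qed
  have U: "T \<in> U (W \<union> T)" if TW: "T \<in> \<T> W" for W T
  proof -
    obtain i where i: "i \<in> I" "T = fragment \<phi> I W i" using TW by (auto simp: \<T>_def)
    obtain j where j: "j \<in> I" "T = \<phi> j - W"
      using fragment[OF I(1) i(1), of \<phi> W] i(2) by metis
    let ?l = "SOME i. i \<in> I \<and> \<phi> i \<subseteq> W \<union> T"
    have ex: "\<exists>i. i \<in> I \<and> \<phi> i \<subseteq> W \<union> T" using j by blast
    have l: "?l \<in> I" "\<phi> ?l \<subseteq> W \<union> fragment \<phi> I W i"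
      using someI_ex[OF ex] i(2) by auto
    have "T \<subseteq> \<phi> ?l"
      unfolding i(2) using fragment_subset_member[OF I(1) i(1) finphi l] i(2) by simp
    then show ?thesis using ex by (auto simp: U_def)
  qed
  have Ufin: "finite (U Z) \<and> card (U Z) \<le> 4 ^ m" for Z
  proof (cases "\<exists>i\<in>I. \<phi> i \<subseteq> Z")
    case True
    let ?l = "SOME i. i \<in> I \<and> \<phi> i \<subseteq> Z"
    have "?l \<in> I" using True someI_ex[of "\<lambda>i. i \<in> I \<and> \<phi> i \<subseteq> Z"] by blast
    then have "finite (\<phi> ?l)" "card (\<phi> ?l) \<le> 2 * m" using I finphi by auto
    moreover have "(4::nat) ^ m = 2 ^ (2 * m)" by (simp add: power_mult)
    ultimately show ?thesis using True by (simp add: U_def card_Pow)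
  qed (simp add: U_def)
  let ?c = "M * (1 / (p * R)) ^ m"
  have c0: "0 \<le> ?c" using M R by simp
  have "bern_avg p V (\<lambda>W. real (card {i \<in> I. m \<le> card (fragment \<phi> I W i)}))
      \<le> (\<Sum>W\<in>Pow V. \<mu> W * (\<Sum>T\<in>\<T> W. M / R ^ card T))"
    unfolding bern_avg_def \<mu>_def[symmetric] using 1 \<mu>0 by (intro sum_mono mult_left_mono) auto
  also have "\<dots> = (\<Sum>(W, T)\<in>Sigma (Pow V) \<T>. \<mu> W * (M / R ^ card T))"
    using V finT by (simp add: sum_distrib_left sum.Sigma)
  also have "\<dots> \<le> (\<Sum>(W, T)\<in>Sigma (Pow V) \<T>. \<mu> (W \<union> T) * ?c)"
    using 2 by (intro sum_mono) auto
  also have "\<dots> = (\<Sum>(Z, T)\<in>(\<lambda>(W, T). (W \<union> T, T)) ` Sigma (Pow V) \<T>. \<mu> Z * ?c)"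
  proof -
    have "inj_on (\<lambda>(W, T). (W \<union> T, T)) (Sigma (Pow V) \<T>)"
      by (rule inj_on_inverseI[where g = "\<lambda>(Z, T). (Z - T, T)"]) (auto dest: frV)
    then show ?thesis by (simp add: sum.reindex case_prod_unfold)
  qed
  also have "\<dots> \<le> (\<Sum>(Z, T)\<in>Sigma (Pow V) U. \<mu> Z * ?c)"
  proof (rule sum_mono2)
    show "finite (Sigma (Pow V) U)" using V Ufin by auto
    show "(\<lambda>(W, T). (W \<union> T, T)) ` Sigma (Pow V) \<T> \<subseteq> Sigma (Pow V) U"
      by (auto dest: frV intro: U)
  qed (use \<mu>0 c0 in \<open>auto simp: mult_nonneg_nonneg simp del: times_divide_eq_right\<close>)
  also have "\<dots> = (\<Sum>Z\<in>Pow V. \<mu> Z * (real (card (U Z)) * ?c))"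
    using V Ufin by (simp add: sum.Sigma[symmetric] algebra_simps)
  also have "\<dots> \<le> (\<Sum>Z\<in>Pow V. \<mu> Z * (4 ^ m * ?c))"
  proof (intro sum_mono mult_left_mono mult_right_mono)
    show "real (card (U Z)) \<le> 4 ^ m" for Z
      using of_nat_mono[of "card (U Z)" "4 ^ m", where 'a = real] Ufin[of Z] by simp
  qed (use c0 \<mu>0 in auto)
  also have "\<dots> = 4 ^ m * ?c"
    using bern_avg_const[OF V, of p "4 ^ m * ?c"] by (simp add: bern_avg_def \<mu>_def)
  also have "\<dots> = M * (4 / (p * R)) ^ m" by (simp add: power_divide)
  finally show ?thesis .
qed

text \<open>Expose \<open>h\<close> independent \<open>p\<close>-random sets one after another. Each
  round replaces members by their fragments and drops the indices whose fragment has not fallen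
  below the next power of two; \<open>bern_avg_large_fragments\<close> bounds the expected loss. In
  the end only empty members survive, and these are covered. The bound \<open>M\<close> is kept
  apart from \<open>card I\<close> because fragments inherit the absolute degree bound while the
  index set shrinks.\<close>

lemma spread_uncovered_bound:
  fixes \<phi> :: "'i \<Rightarrow> 'a set" and M p R :: real
  assumes V: "finite V" and p: "0 < p" "p < 1" and R: "0 < R" "1 \<le> p * R" and M: "0 \<le> M"
    and I: "finite I" "\<And>i. i \<in> I \<Longrightarrow> \<phi> i \<subseteq> V" "\<And>i. i \<in> I \<Longrightarrow> card (\<phi> i) < 2 ^ h"
    and sp: "\<And>X. X \<subseteq> V \<Longrightarrow> real (card {i \<in> I. X \<subseteq> \<phi> i}) \<le> M / R ^ card X"
  shows "real (card I) * bern_avg (1 - (1 - p) ^ h) V (\<lambda>W. if \<exists>i\<in>I. \<phi> i \<subseteq> W then 0 else 1)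
    \<le> M * (\<Sum>g<h. (4 / (p * R)) ^ (2 ^ g))"
  using I sp
proof (induction h arbitrary: I \<phi>)
  case 0
  have "finite (\<phi> i)" if "i \<in> I" for i using 0 V that finite_subset by blast
  then have "\<phi> i = {}" if "i \<in> I" for i using 0(3)[OF that] that by simp
  then have "I = {} \<or> (\<forall>W. \<exists>i\<in>I. \<phi> i \<subseteq> W)" by blast
  then show ?case by (auto simp: bern_avg_def)
next
  case (Suc h)
  let ?q = "1 - (1 - p) ^ h"
  let ?J = "\<lambda>W. {i \<in> I. card (fragment \<phi> I W i) < 2 ^ h}"
  let ?K = "\<lambda>W. {i \<in> I. 2 ^ h \<le> card (fragment \<phi> I W i)}"
  let ?f = "\<lambda>W. if \<exists>i\<in>I. \<phi> i \<subseteq> W then 0 else (1::real)"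
  let ?s = "\<Sum>g<h. (4 / (p * R)) ^ (2 ^ g)"
  have q: "0 \<le> ?q" "?q \<le> 1" using p by (auto simp: power_le_one)
  \<comment> \<open>Indices with small fragments are handled by the induction hypothesis; each of
    the others counts as uncovered. The factors \<open>1 *\<close> give the bound the shape of
    \<open>bern_avg_linear\<close>.\<close>
  have step: "real (card I) * bern_avg ?q V (\<lambda>B. ?f (A \<union> B)) \<le> 1 * (M * ?s) + 1 * real (card (?K A))"
    if A: "A \<subseteq> V" for A
  proof -
    let ?x = "bern_avg ?q V (\<lambda>B. ?f (A \<union> B))"
    let ?g = "\<lambda>B. if \<exists>i\<in>?J A. fragment \<phi> I A i \<subseteq> B then 0 else (1::real)"
    have "card I = card (?J A) + card (?K A)"
    proof -
      have "card (?J A \<union> ?K A) = card (?J A) + card (?K A)"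
        by (rule card_Un_disjoint) (use Suc.prems(1) in auto)
      moreover have "?J A \<union> ?K A = I" by auto
      ultimately show ?thesis by simp
    qed
    then have split: "real (card I) * ?x = real (card (?J A)) * ?x + real (card (?K A)) * ?x"
      by (simp add: algebra_simps)
    have xg: "?x \<le> bern_avg ?q V ?g"
    proof (rule bern_avg_mono[OF q])
      fix B assume "B \<subseteq> V"
      have "\<exists>j\<in>I. \<phi> j \<subseteq> A \<union> B" if "i \<in> I" "fragment \<phi> I A i \<subseteq> B" for i
        using fragment[OF Suc.prems(1) that(1), of \<phi> A] that(2) by (metis Diff_subset_conv)
      then show "?f (A \<union> B) \<le> ?g B" by auto
    qed
    have "?x \<le> bern_avg ?q V (\<lambda>_. 1)"
      by (rule bern_avg_mono[OF q]) auto
    then have x1: "?x \<le> 1" by (simp add: bern_avg_const[OF V])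
    have "real (card (?J A)) * bern_avg ?q V ?g \<le> M * ?s"
    proof (rule Suc.IH)
      show "finite (?J A)" using Suc.prems(1) by simp
      show "fragment \<phi> I A i \<subseteq> V" if "i \<in> ?J A" for i
        using fragment_subset[OF Suc.prems(1), of i \<phi> A] Suc.prems(2)[of i] that by auto
      show "card (fragment \<phi> I A i) < 2 ^ h" if "i \<in> ?J A" for i using that by simp
      show "real (card {i \<in> ?J A. X \<subseteq> fragment \<phi> I A i}) \<le> M / R ^ card X" if "X \<subseteq> V" for X
      proof -
        have "{i \<in> ?J A. X \<subseteq> fragment \<phi> I A i} \<subseteq> {i \<in> I. X \<subseteq> \<phi> i}"
          using fragment_subset[OF Suc.prems(1), of _ \<phi> A] by blast
        then have "card {i \<in> ?J A. X \<subseteq> fragment \<phi> I A i} \<le> card {i \<in> I. X \<subseteq> \<phi> i}"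
          using Suc.prems(1) by (intro card_mono) auto
        then show ?thesis using Suc.prems(4)[OF that] by linarith
      qed
    qed
    moreover have "real (card (?J A)) * ?x \<le> real (card (?J A)) * bern_avg ?q V ?g"
      using xg by (intro mult_left_mono) auto
    moreover have "real (card (?K A)) * ?x \<le> real (card (?K A)) * 1"
      using x1 by (intro mult_left_mono) auto
    ultimately show ?thesis using split by simp
  qed
  have "real (card I) * bern_avg (1 - (1 - p) ^ Suc h) V ?f
      = real (card I) * bern_avg p V (\<lambda>A. bern_avg ?q V (\<lambda>B. ?f (A \<union> B)))"
    by (subst bern_avg_Un[OF V]) simp
  also have "\<dots> = bern_avg p V (\<lambda>A. real (card I) * bern_avg ?q V (\<lambda>B. ?f (A \<union> B)))"
    using bern_avg_linear[of p V "real (card I)" _ 0] by simp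
  also have "\<dots> \<le> bern_avg p V (\<lambda>A. 1 * (M * ?s) + 1 * real (card (?K A)))"
    using p step by (intro bern_avg_mono) auto
  also have "\<dots> = M * ?s + bern_avg p V (\<lambda>A. real (card (?K A)))"
    by (subst bern_avg_linear) (simp add: bern_avg_const[OF V])
  also have "bern_avg p V (\<lambda>A. real (card (?K A))) \<le> M * (4 / (p * R)) ^ (2 ^ h)"
  proof (rule bern_avg_large_fragments[OF V p R M Suc.prems(1,2)])
    show "card (\<phi> i) \<le> 2 * 2 ^ h" if "i \<in> I" for i using Suc.prems(3)[OF that] by simp
  qed (use Suc.prems(4) in auto)
  finally show ?case by (simp add: algebra_simps)
qed

text \<open>About \<open>ln k\<close> rounds bring member sizes below 1. Their common density
  \<open>p\<close> is of order \<open>1 / ln k\<close>, so \<open>p * R\<close> is bounded below by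
  a large constant and the losses of all rounds sum to less than 1/2.\<close>

lemma spread_uncovered_half:
  fixes \<phi> :: "'i \<Rightarrow> 'a set" and R :: real
  assumes V: "finite V" and k: "2 \<le> k" and R: "2 ^ 13 * ln (real k) \<le> R"
    and I: "finite I" "I \<noteq> {}" "\<And>i. i \<in> I \<Longrightarrow> \<phi> i \<subseteq> V" "\<And>i. i \<in> I \<Longrightarrow> card (\<phi> i) \<le> k"
    and sp: "\<And>X. X \<subseteq> V \<Longrightarrow> real (card {i \<in> I. X \<subseteq> \<phi> i}) \<le> real (card I) / R ^ card X"
  shows "bern_avg (1 / 2) V (\<lambda>W. if \<exists>i\<in>I. \<phi> i \<subseteq> W then 0 else 1) < 1 / 2"
proof -
  obtain n where n: "2 ^ n \<le> k" "k < 2 ^ (n + 1)"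
    using ex_power_ivl1[of 2 k] k by auto
  define h where "h = n + 1"
  have n1: "1 \<le> n" using n k by (cases n) auto
  have "real n * ln 2 = ln (2 ^ n)" by (simp add: ln_realpow)
  also have "\<dots> \<le> ln (real k)"
    using of_nat_mono[OF n(1), where 'a = real] k by (intro ln_mono) auto
  \<comment> \<open>Since \<open>ln 2\<close> is at least 2/3 and \<open>n\<close> at least 1, this
    gives \<open>h = n + 1 \<le> 2 * n \<le> 3 * ln k\<close>.\<close>
  finally have "real n * (2 / 3) \<le> ln (real k)"
    using mult_left_mono[OF ln2_ge_two_thirds, of "real n"] by linarith
  then have h: "real h \<le> 3 * ln (real k)" using n1 by (simp add: h_def)
  have lnk: "0 < ln (real k)" using k by simp
  have h0: "0 < h" by (simp add: h_def)
  \<comment> \<open>With this root the union of \<open>h\<close> rounds has density exactly 1/2, the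
    density at which a random set and its complement have the same distribution.\<close>
  define s where "s = root h (1 / 2)"
  define p where "p = 1 - s"
  have s: "s ^ h = 1 / 2" "0 < s" using h0 by (simp_all add: s_def)
  have "s \<le> 1 - 1 / (2 * real h)"
  proof (rule ccontr)
    assume "\<not> ?thesis"
    then have *: "1 - 1 / (2 * real h) < s" by simp
    have "1 + real h * (- (1 / (2 * real h))) \<le> (1 + (- (1 / (2 * real h)))) ^ h"
      using h0 by (intro Bernoulli_inequality) (simp add: field_simps)
    moreover have "(1 - 1 / (2 * real h)) ^ h < s ^ h"
      using * h0 by (intro power_strict_mono) (auto simp: field_simps)
    ultimately show False using s h0 by simp
  qed
  then have ph: "1 / (2 * real h) \<le> p" by (simp add: p_def)
  have "0 < 1 / (2 * real h)" using h0 by simp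
  then have "0 < p" using ph by linarith
  moreover have "p < 1" using s(2) by (simp add: p_def)
  ultimately have p: "0 < p" "p < 1" by auto
  have R0: "0 < R" using R lnk by (smt (verit) zero_less_power mult_pos_pos)
  have "64 \<le> (2 ^ 13 * ln (real k)) * (1 / (2 * real h))"
    using h h0 lnk by (simp add: field_simps)
  also have "\<dots> \<le> R * p" using R ph R0 h0 by (intro mult_mono) auto
  finally have pR: "64 \<le> p * R" by (simp add: mult.commute)
  let ?c = "4 / (p * R)"
  have c: "0 \<le> ?c" "?c \<le> 1 / 16" using pR by (auto simp: field_simps)
  \<comment> \<open>The doubly exponential terms are relaxed to a geometric series through
    \<open>Suc g \<le> 2 ^ g\<close>.\<close>
  have "(\<Sum>g<h. ?c ^ (2 ^ g)) \<le> (\<Sum>g<h. (1 / 16) * (1 / 2) ^ g)"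
  proof (rule sum_mono)
    fix g
    have "Suc g \<le> 2 ^ g" by (simp add: Suc_leI)
    then have "?c ^ (2 ^ g) \<le> ?c ^ Suc g" using c by (intro power_decreasing) auto
    also have "\<dots> \<le> (1 / 16) ^ Suc g" using c by (intro power_mono) auto
    also have "\<dots> \<le> (1 / 16) * (1 / 2) ^ g" by (simp add: power_mono)
    finally show "?c ^ (2 ^ g) \<le> (1 / 16) * (1 / 2) ^ g" .
  qed
  also have "\<dots> = (1 / 16) * (2 - 2 * (1 / 2) ^ h)"
    by (induction h) (simp_all add: algebra_simps)
  also have "\<dots> < 1 / 2" by (simp add: algebra_simps add_pos_nonneg)
  finally have sum: "(\<Sum>g<h. ?c ^ (2 ^ g)) < 1 / 2" .
  let ?f = "\<lambda>W. if \<exists>i\<in>I. \<phi> i \<subseteq> W then 0 else (1::real)"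
  have "real (card I) * bern_avg (1 - (1 - p) ^ h) V ?f \<le> real (card I) * (\<Sum>g<h. ?c ^ (2 ^ g))"
  proof (rule spread_uncovered_bound[OF V p R0 _ _ I(1,3)])
    show "card (\<phi> i) < 2 ^ h" if "i \<in> I" for i
      using I(4)[OF that] n(2) by (simp add: h_def)
  qed (use pR sp in auto)
  moreover have "0 < card I" using I by (simp add: card_gt_0_iff)
  ultimately have "bern_avg (1 - (1 - p) ^ h) V ?f \<le> (\<Sum>g<h. ?c ^ (2 ^ g))" by simp
  moreover have "1 - (1 - p) ^ h = 1 / 2" using s by (simp add: p_def)
  ultimately show ?thesis using sum by simp
qed

lemma bern_avg_half_compl: "bern_avg (1 / 2) V (\<lambda>W. f (V - W)) = bern_avg (1 / 2) V f"
  unfolding bern_avg_def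
  by (rule sum.reindex_bij_witness[where i = "\<lambda>W. V - W" and j = "\<lambda>W. V - W"])
    (auto simp: double_diff mult.commute)

text \<open>The complement of a uniformly random set is again uniform. Two failure probabilities
  below 1/2 leave a set \<open>W\<close> containing a member of the first family whose complement
  contains one of the second.\<close>

lemma spread_disjoint_pair:
  fixes \<phi> :: "'i \<Rightarrow> 'a set" and \<psi> :: "'j \<Rightarrow> 'a set" and R :: real
  assumes V: "finite V" and k: "2 \<le> k" and R: "2 ^ 13 * ln (real k) \<le> R"
    and I: "finite I" "I \<noteq> {}" "\<And>i. i \<in> I \<Longrightarrow> \<phi> i \<subseteq> V" "\<And>i. i \<in> I \<Longrightarrow> card (\<phi> i) \<le> k"
      "\<And>X. X \<subseteq> V \<Longrightarrow> real (card {i \<in> I. X \<subseteq> \<phi> i}) \<le> real (card I) / R ^ card X"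
    and J: "finite J" "J \<noteq> {}" "\<And>j. j \<in> J \<Longrightarrow> \<psi> j \<subseteq> V" "\<And>j. j \<in> J \<Longrightarrow> card (\<psi> j) \<le> k"
      "\<And>X. X \<subseteq> V \<Longrightarrow> real (card {j \<in> J. X \<subseteq> \<psi> j}) \<le> real (card J) / R ^ card X"
  obtains i j where "i \<in> I" "j \<in> J" "\<phi> i \<inter> \<psi> j = {}"
proof -
  let ?f = "\<lambda>W. if \<exists>i\<in>I. \<phi> i \<subseteq> W then 0 else (1::real)"
  let ?g = "\<lambda>W. if \<exists>j\<in>J. \<psi> j \<subseteq> W then 0 else (1::real)"
  have "bern_avg (1 / 2) V ?f < 1 / 2" by (rule spread_uncovered_half[OF V k R I])
  moreover have "bern_avg (1 / 2) V (\<lambda>W. ?g (V - W)) < 1 / 2"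
    using spread_uncovered_half[OF V k R J] bern_avg_half_compl[of V ?g] by simp
  ultimately have "bern_avg (1 / 2) V (\<lambda>W. 1 * ?f W + 1 * ?g (V - W)) < 1"
    unfolding bern_avg_linear by simp
  then have "\<not> bern_avg (1 / 2) V (\<lambda>_. 1) \<le> bern_avg (1 / 2) V (\<lambda>W. 1 * ?f W + 1 * ?g (V - W))"
    using bern_avg_const[OF V, of "1 / 2" 1] by linarith
  then obtain W where "W \<subseteq> V" "\<not> 1 \<le> ?f W + ?g (V - W)"
    using bern_avg_mono[of "1 / 2" V "\<lambda>_. 1" "\<lambda>W. 1 * ?f W + 1 * ?g (V - W)"] by auto
  then have "\<exists>i\<in>I. \<phi> i \<subseteq> W" "\<exists>j\<in>J. \<psi> j \<subseteq> V - W" by (auto split: if_splits)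
  then show ?thesis using that by blast
qed

subsection \<open>Nontrivial t-intersecting families\<close>

abbreviation deg :: "'a set set \<Rightarrow> 'a set \<Rightarrow> nat" where
  "deg \<G> X \<equiv> card (containing \<G> X)"

definition t_intersecting :: "nat \<Rightarrow> 'a set set \<Rightarrow> bool" where
  "t_intersecting t \<T> \<longleftrightarrow> (\<forall>S\<in>\<T>. \<forall>S'\<in>\<T>. t \<le> card (S \<inter> S'))"

definition nontrivial :: "'a set \<Rightarrow> nat \<Rightarrow> 'a set set \<Rightarrow> bool" where
  "nontrivial V t \<T> \<longleftrightarrow> \<not> (\<exists>T\<in>nsets V t. \<forall>S\<in>\<T>. T \<subseteq> S)"

text \<open>No member can be shrunk without destroying the \<open>t\<close>-intersection property.
  The witness \<open>S\<close> may be \<open>B\<close> itself, which accounts for subsets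
  \<open>Y\<close> with fewer than \<open>t\<close> elements.\<close>

definition irreducible_family :: "nat \<Rightarrow> 'a set set \<Rightarrow> bool" where
  "irreducible_family t \<T> \<longleftrightarrow> (\<forall>B\<in>\<T>. \<forall>Y. Y \<subset> B \<longrightarrow> (\<exists>S\<in>\<T>. card (Y \<inter> S) < t))"

text \<open>Branching: as long as \<open>X\<close> is a proper subset of a member, irreducibility
  yields some \<open>S\<close> meeting \<open>X\<close> in fewer than \<open>t\<close> elements.
  Every member above \<open>X\<close> then contains an element of \<open>S - X\<close>. If
  \<open>B0\<close> is a member of size \<open>m\<close> above \<open>X\<close>, then
  \<open>S - B0\<close> and \<open>B0 - X\<close> each have at most \<open>m - t\<close> elements,
  so there are at most \<open>2 * (m - t)\<close> branches.\<close>

lemma irreducible_layer_link_bound: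
  assumes V: "finite V" and \<T>: "\<T> \<subseteq> Pow V" "t_intersecting t \<T>" "\<And>S. S \<in> \<T> \<Longrightarrow> card S \<le> m"
    "irreducible_family t \<T>"
    and X: "t \<le> card X" "card X + j = m"
  shows "card {B \<in> \<T>. card B = m \<and> X \<subseteq> B} \<le> (2 * (m - t)) ^ j"
  using X
proof (induction j arbitrary: X)
  case 0
  have "{B \<in> \<T>. card B = m \<and> X \<subseteq> B} \<subseteq> {X}"
  proof
    fix B assume B: "B \<in> {B \<in> \<T>. card B = m \<and> X \<subseteq> B}"
    then have "B \<subseteq> V" using \<T>(1) by auto
    then have "finite B" using V by (rule finite_subset)
    then have "X = B" using B 0 by (intro card_subset_eq) auto
    then show "B \<in> {X}" by simp
  qed
  then have "card {B \<in> \<T>. card B = m \<and> X \<subseteq> B} \<le> card {X}" by (intro card_mono) auto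
  then show ?case by simp
next
  case (Suc j)
  let ?L = "\<lambda>X. {B \<in> \<T>. card B = m \<and> X \<subseteq> B}"
  show ?case
  proof (cases "?L X = {}")
    case False
    then obtain B0 where B0: "B0 \<in> \<T>" "card B0 = m" "X \<subseteq> B0" by auto
    have fin: "finite B" if "B \<in> \<T>" for B using V \<T> that finite_subset by blast
    have "X \<subset> B0" using B0 Suc.prems by auto
    then obtain S where S: "S \<in> \<T>" "card (X \<inter> S) < t"
      using \<T>(4) B0(1) unfolding irreducible_family_def by blast
    have "?L X \<subseteq> (\<Union>y\<in>S - X. ?L (insert y X))"
    proof
      fix B assume B: "B \<in> ?L X"
      then have "t \<le> card (B \<inter> S)" using \<T> S by (auto simp: t_intersecting_def)
      then have "\<not> B \<inter> S \<subseteq> X \<inter> S"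
        using S fin card_mono[of "X \<inter> S" "B \<inter> S"] by fastforce
      then show "B \<in> (\<Union>y\<in>S - X. ?L (insert y X))" using B by auto
    qed
    then have "card (?L X) \<le> card (\<Union>y\<in>S - X. ?L (insert y X))"
      using S fin finite_subset[OF \<T>(1)] V by (intro card_mono) auto
    also have "\<dots> \<le> (\<Sum>y\<in>S - X. card (?L (insert y X)))"
      using S fin by (intro card_UN_le) auto
    also have "\<dots> \<le> (\<Sum>y\<in>S - X. (2 * (m - t)) ^ j)"
    proof (rule sum_mono)
      fix y assume y: "y \<in> S - X"
      have "finite X" using B0 fin finite_subset by blast
      then have "card (insert y X) = Suc (card X)" using y by simp
      then show "card (?L (insert y X)) \<le> (2 * (m - t)) ^ j"
        using Suc.prems by (intro Suc.IH) auto
    qed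
    also have "\<dots> = card (S - X) * (2 * (m - t)) ^ j" by simp
    also have "card (S - X) \<le> 2 * (m - t)"
    proof -
      have "card (S - B0) = card S - card (S \<inter> B0)"
        using fin S by (simp add: card_Diff_subset_Int)
      moreover have "t \<le> card (S \<inter> B0)" using \<T> S B0 by (auto simp: t_intersecting_def)
      ultimately have "card (S - B0) \<le> m - t" using \<T>(3)[OF S(1)] by simp
      moreover have "card (B0 - X) \<le> m - t"
        using B0 fin Suc.prems by (subst card_Diff_subset) (auto intro: finite_subset)
      moreover have "card (S - X) \<le> card ((S - B0) \<union> (B0 - X))"
        using fin S B0 by (intro card_mono) auto
      ultimately show ?thesis using card_Un_le[of "S - B0" "B0 - X"] by linarith
    qed
    finally show ?thesis by simp
  qed (metis card.empty zero_le)
qed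

text \<open>Every member shares a \<open>t\<close>-set with one fixed member of size
  \<open>m\<close>; branching starts from each of these \<open>t\<close>-sets.\<close>

lemma irreducible_layer_bound:
  assumes V: "finite V" and \<T>: "\<T> \<subseteq> Pow V" "t_intersecting t \<T>" "\<And>S. S \<in> \<T> \<Longrightarrow> card S \<le> m"
    "irreducible_family t \<T>" and tm: "t \<le> m"
  shows "card {B \<in> \<T>. card B = m} \<le> (m choose (m - t)) * (2 * (m - t)) ^ (m - t)"
proof (cases "{B \<in> \<T>. card B = m} = {}")
  case False
  let ?L = "\<lambda>X. {B \<in> \<T>. card B = m \<and> X \<subseteq> B}"
  obtain B0 where B0: "B0 \<in> \<T>" "card B0 = m" using False by auto
  have fin: "finite B" if "B \<in> \<T>" for B using V \<T> that finite_subset by blast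
  let ?\<X> = "{X. X \<subseteq> B0 \<and> card X = t}"
  have fX: "finite ?\<X>" using fin[OF B0(1)] by simp
  have "{B \<in> \<T>. card B = m} \<subseteq> (\<Union>X\<in>?\<X>. ?L X)"
  proof
    fix B assume B: "B \<in> {B \<in> \<T>. card B = m}"
    then have "t \<le> card (B \<inter> B0)" using \<T> B0 by (auto simp: t_intersecting_def)
    then obtain X where "X \<subseteq> B \<inter> B0" "card X = t" by (meson obtain_subset_with_card_n)
    then show "B \<in> (\<Union>X\<in>?\<X>. ?L X)" using B by auto
  qed
  then have "card {B \<in> \<T>. card B = m} \<le> card (\<Union>X\<in>?\<X>. ?L X)"
    using fX finite_subset[OF \<T>(1)] V by (intro card_mono) auto
  also have "\<dots> \<le> (\<Sum>X\<in>?\<X>. card (?L X))" by (rule card_UN_le[OF fX])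
  also have "\<dots> \<le> (\<Sum>X\<in>?\<X>. (2 * (m - t)) ^ (m - t))"
    using tm by (intro sum_mono irreducible_layer_link_bound[OF V \<T>]) auto
  also have "\<dots> = (m choose (m - t)) * (2 * (m - t)) ^ (m - t)"
    using n_subsets[OF fin[OF B0(1)], of t] B0 tm by (simp add: binomial_symmetric[symmetric])
  finally show ?thesis .
qed (metis card.empty zero_le)

text \<open>A single term of the exponential series at \<open>d\<close> is at most
  \<open>exp d\<close>.\<close>

lemma self_power_le_fact: "real d ^ d \<le> 3 ^ d * fact d"
proof -
  have "(\<Sum>n\<in>{d}. inverse (fact n) * real d ^ n) \<le> (\<Sum>n. inverse (fact n) * real d ^ n)"
    using summable_exp[of "real d"] by (intro sum_le_suminf) auto
  then have "real d ^ d / fact d \<le> exp (real d)"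
    by (simp add: exp_def divide_inverse mult.commute)
  also have "\<dots> = exp 1 ^ d" by (simp add: exp_of_nat_mult[symmetric])
  also have "\<dots> \<le> 3 ^ d" using exp_le by (intro power_mono) auto
  finally show ?thesis by (simp add: field_simps)
qed

text \<open>The factorial in the denominator of the binomial bound cancels the one in
  \<open>self_power_le_fact\<close>. The layer size becomes a pure \<open>d\<close>-th power,
  comparable with the spread factor \<open>r ^ d\<close>.\<close>

lemma binomial_double_power_le: "real ((m choose d) * (2 * d) ^ d) \<le> (6 * real m) ^ d"
proof -
  have "real (m choose d) * fact d \<le> real m ^ d"
    using binomial_fact_pow[of m d] by (metis of_nat_fact of_nat_le_iff of_nat_mult of_nat_power)
  then have *: "real (m choose d) \<le> real m ^ d / fact d" by (simp add: field_simps)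
  have "real ((m choose d) * (2 * d) ^ d) = real (m choose d) * (2 ^ d * real d ^ d)"
    by (simp add: power_mult_distrib)
  also have "\<dots> \<le> real m ^ d / fact d * (2 ^ d * (3 ^ d * fact d))"
    using * self_power_le_fact[of d] by (intro mult_mono) auto
  also have "\<dots> = (2 * 3 * real m) ^ d" by (simp only: power_mult_distrib) simp
  finally show ?thesis by simp
qed

text \<open>Replacing a reducible member by a smaller witness lowers the sum of the sizes, so the
  process stops. Shrinking preserves nontriviality, since a \<open>t\<close>-set inside the smaller
  set lies in the old member too.\<close>

lemma irreducible_reduction_exists:
  assumes V: "finite V" and \<T>: "\<T> \<subseteq> Pow V" "t_intersecting t \<T>" "\<And>S. S \<in> \<T> \<Longrightarrow> card S \<le> m"
    "nontrivial V t \<T>"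
  shows "\<exists>\<T>'. \<T>' \<subseteq> Pow V \<and> t_intersecting t \<T>' \<and> (\<forall>S\<in>\<T>'. card S \<le> m) \<and>
    nontrivial V t \<T>' \<and> irreducible_family t \<T>' \<and> (\<forall>S\<in>\<T>. \<exists>S'\<in>\<T>'. S' \<subseteq> S)"
  using \<T>
proof (induction "sum card \<T>" arbitrary: \<T> rule: less_induct)
  case less
  show ?case
  proof (cases "irreducible_family t \<T>")
    case True
    then show ?thesis using less.prems by (intro exI[of _ \<T>]) auto
  next
    case False
    then obtain B Y where B: "B \<in> \<T>" "Y \<subset> B" "\<And>S. S \<in> \<T> \<Longrightarrow> t \<le> card (Y \<inter> S)"
      by (auto simp: irreducible_family_def not_less)
    let ?\<T> = "insert Y (\<T> - {B})"
    have fin: "finite \<T>" "finite B" using less.prems(1) V B(1)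
      by (auto intro: finite_subset[of _ "Pow V"] finite_subset[of _ V])
    have YB: "card Y < card B" using B fin by (simp add: psubset_card_mono)
    \<comment> \<open>Only an inequality, since \<open>Y\<close> may already be another
      member.\<close>
    have "sum card ?\<T> \<le> card Y + sum card (\<T> - {B})"
      using fin by (simp add: sum.insert_if)
    also have "\<dots> < sum card \<T>" using YB B fin by (simp add: sum.remove)
    finally have lt: "sum card ?\<T> < sum card \<T>" .
    \<comment> \<open>The case \<open>S = B\<close> shows that \<open>Y\<close> meets itself in at
      least \<open>t\<close> elements.\<close>
    have "card Y \<ge> t" using B(3)[OF B(1)] B(2) by (simp add: Int_absorb2 psubset_imp_subset)
    then have "t_intersecting t ?\<T>"
      using less.prems(2) B(3) by (auto simp: t_intersecting_def Int_commute)
    moreover have "?\<T> \<subseteq> Pow V" using less.prems(1) B by auto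
    moreover have "card S \<le> m" if "S \<in> ?\<T>" for S
      using that less.prems(3) less.prems(3)[OF B(1)] YB by auto
    moreover have "nontrivial V t ?\<T>"
      using less.prems(4) B(1,2) unfolding nontrivial_def by blast
    ultimately obtain \<T>' where \<T>': "\<T>' \<subseteq> Pow V" "t_intersecting t \<T>'" "\<forall>S\<in>\<T>'. card S \<le> m"
      "nontrivial V t \<T>'" "irreducible_family t \<T>'" "\<forall>S\<in>?\<T>. \<exists>S'\<in>\<T>'. S' \<subseteq> S"
      using less.hyps[OF lt] by blast
    have "\<exists>S'\<in>\<T>'. S' \<subseteq> S" if "S \<in> \<T>" for S
    proof (cases "S = B")
      case True
      then show ?thesis using \<T>'(6) B(2) by (meson insertI1 order_trans psubset_imp_subset)
    next
      case False
      then show ?thesis using \<T>'(6) that by simp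
    qed
    then show ?thesis using \<T>' by blast
  qed
qed

text \<open>Two sets of size at most \<open>t\<close> that meet in \<open>t\<close> elements
  coincide, so a nonempty family would be one \<open>t\<close>-set, contained in all
  members.\<close>

lemma nontrivial_card_le_empty:
  assumes V: "finite V" and \<T>: "\<T> \<subseteq> Pow V" "t_intersecting t \<T>" "\<And>S. S \<in> \<T> \<Longrightarrow> card S \<le> t"
    "nontrivial V t \<T>"
  shows "\<T> = {}"
proof (rule ccontr)
  assume "\<T> \<noteq> {}"
  then obtain S where S: "S \<in> \<T>" by auto
  have fin: "finite S'" if "S' \<in> \<T>" for S' using \<T>(1) V that by (auto intro: finite_subset)
  have "S \<subseteq> S'" if "S' \<in> \<T>" for S'
  proof -
    have "card S \<le> card (S \<inter> S')"
      using \<T>(2) \<T>(3)[OF S] S that unfolding t_intersecting_def by (meson order_trans)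
    then have "S \<inter> S' = S" using fin[OF S] by (intro card_seteq) auto
    then show ?thesis by auto
  qed
  moreover have "t \<le> card (S \<inter> S)" using \<T>(2) S unfolding t_intersecting_def by blast
  then have "S \<in> nsets V t" using \<T>(1) \<T>(3)[OF S] S fin[OF S] by (auto simp: nsets_def)
  ultimately show False using \<T>(4) unfolding nontrivial_def by blast
qed

text \<open>Here \<open>M\<close> bounds the degrees of \<open>t\<close>-sets and \<open>j\<close>
  is the excess of the largest support over \<open>t\<close>. After reduction to an irreducible
  family the top layer contributes one power of \<open>6 * q / r\<close>, and the remaining layers
  are treated inductively. If they have become trivial, the recursion stops with a single
  contribution \<open>q / r\<close>.\<close>

lemma nontrivial_intersecting_cover_bound:
  fixes r M :: real
  assumes V: "finite V" and \<A>: "finite \<A>" and r: "0 < r" and M: "0 \<le> M"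
    and deg: "\<And>X. X \<subseteq> V \<Longrightarrow> t \<le> card X \<Longrightarrow> card X \<le> q \<Longrightarrow> real (deg \<A> X) \<le> M / r ^ (card X - t)"
    and \<T>: "\<T> \<subseteq> Pow V" "t_intersecting t \<T>" "\<And>S. S \<in> \<T> \<Longrightarrow> card S \<le> t + j" "nontrivial V t \<T>"
    and q: "t + j \<le> q"
  shows "real (card (\<Union>S\<in>\<T>. containing \<A> S)) \<le> M * (real q / r + (\<Sum>d=1..j. (6 * real q / r) ^ d))"
  using \<T> q
proof (induction j arbitrary: \<T>)
  case 0
  have "\<T> = {}" using nontrivial_card_le_empty[OF V 0(1,2) _ 0(4)] 0(3) by simp
  then show ?case using M r by simp
next
  case (Suc j)
  let ?m = "t + Suc j"
  let ?U = "\<lambda>\<T>. \<Union>S\<in>\<T>. containing \<A> S"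
  obtain \<T>' where *: "\<T>' \<subseteq> Pow V" "t_intersecting t \<T>'" "\<forall>S\<in>\<T>'. card S \<le> ?m"
    "nontrivial V t \<T>'" "irreducible_family t \<T>'" "\<forall>S\<in>\<T>. \<exists>S'\<in>\<T>'. S' \<subseteq> S"
    using irreducible_reduction_exists[OF V Suc.prems(1-4)] by blast
  note \<T>' = *(1,2) bspec[OF *(3)] *(4,5) bspec[OF *(6)]
  have fin: "finite S" if "S \<in> \<T>'" for S using \<T>'(1) V that finite_subset by blast
  have finT: "finite \<T>'" using \<T>'(1) V by (auto intro: finite_subset[of _ "Pow V"])
  define \<W> where "\<W> = {B \<in> \<T>'. card B = ?m}"
  define \<T>'' where "\<T>'' = \<T>' - \<W>"
  have finA: "finite (containing \<A> S)" for S using \<A> by (simp add: containing_def)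
  have finU: "finite (?U \<T>)" for \<T>
    by (rule finite_subset[OF _ \<A>]) (auto simp: containing_def)
  have "?U \<T> \<subseteq> ?U \<T>'' \<union> ?U \<W>"
  proof
    fix A assume "A \<in> ?U \<T>"
    then obtain S where S: "S \<in> \<T>" "A \<in> \<A>" "S \<subseteq> A" by (auto simp: containing_def)
    obtain S' where "S' \<in> \<T>'" "S' \<subseteq> S" using \<T>'(6)[OF S(1)] by blast
    then show "A \<in> ?U \<T>'' \<union> ?U \<W>"
      using S(2,3) unfolding containing_def \<T>''_def by blast
  qed
  then have "card (?U \<T>) \<le> card (?U \<T>'' \<union> ?U \<W>)" using finU by (intro card_mono) auto
  also have "\<dots> \<le> card (?U \<T>'') + card (?U \<W>)" by (rule card_Un_le)
  finally have 1: "card (?U \<T>) \<le> card (?U \<T>'') + card (?U \<W>)" .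
  have sub: "\<T>'' \<subseteq> \<T>'" by (auto simp: \<T>''_def)
  have size: "card S \<le> t + j" if "S \<in> \<T>''" for S
    using that \<T>'(3)[of S] by (auto simp: \<T>''_def \<W>_def)
  have 2: "real (card (?U \<T>'')) \<le> M * (real q / r + (\<Sum>d=1..j. (6 * real q / r) ^ d))"
  proof (cases "nontrivial V t \<T>''")
    case True
    have "t_intersecting t \<T>''" using \<T>'(2) sub unfolding t_intersecting_def by blast
    then show ?thesis using True sub \<T>'(1) size Suc.prems(5) by (intro Suc.IH) auto
  next
    case False
    then obtain T where T: "T \<in> nsets V t" "\<And>S. S \<in> \<T>'' \<Longrightarrow> T \<subseteq> S" by (auto simp: nontrivial_def)
    have T': "T \<subseteq> V" "finite T" "card T = t" using T(1) by (auto simp: nsets_def)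
    \<comment> \<open>The lower layers share \<open>T\<close>, but the full reduced family is
      nontrivial, so some \<open>B\<close> omits part of \<open>T\<close>. Each lower member must
      meet \<open>B\<close> outside \<open>T\<close>, hence contains \<open>T\<close> and a further
      element of \<open>B\<close>.\<close>
    obtain B where B: "B \<in> \<T>'" "\<not> T \<subseteq> B" using \<T>'(4) T(1) unfolding nontrivial_def by blast
    have "?U \<T>'' \<subseteq> (\<Union>y\<in>B - T. containing \<A> (insert y T))"
    proof
      fix A assume "A \<in> ?U \<T>''"
      then obtain S where S: "S \<in> \<T>''" "A \<in> \<A>" "S \<subseteq> A" by (auto simp: containing_def)
      have tc: "t \<le> card (S \<inter> B)" using S B sub \<T>'(2) by (auto simp: t_intersecting_def)
      have "\<not> S \<inter> B \<subseteq> T"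
      proof
        assume "S \<inter> B \<subseteq> T"
        then have "S \<inter> B = T" using tc T' by (intro card_seteq) auto
        then show False using B by auto
      qed
      then show "A \<in> (\<Union>y\<in>B - T. containing \<A> (insert y T))"
        using S T(2)[OF S(1)] by (auto simp: containing_def)
    qed
    then have "card (?U \<T>'') \<le> card (\<Union>y\<in>B - T. containing \<A> (insert y T))"
      using fin[OF B(1)] finA by (intro card_mono) auto
    also have "\<dots> \<le> (\<Sum>y\<in>B - T. deg \<A> (insert y T))" using fin[OF B(1)] by (intro card_UN_le) auto
    finally have "real (card (?U \<T>'')) \<le> (\<Sum>y\<in>B - T. real (deg \<A> (insert y T)))"
      unfolding of_nat_sum[symmetric] by (simp only: of_nat_le_iff)
    also have "\<dots> \<le> (\<Sum>y\<in>B - T. M / r)"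
    proof (rule sum_mono)
      fix y assume y: "y \<in> B - T"
      have "card (insert y T) = Suc t" using y T' by simp
      then show "real (deg \<A> (insert y T)) \<le> M / r"
        using deg[of "insert y T"] y T'(1) B(1) \<T>'(1) Suc.prems(5) by auto
    qed
    also have "\<dots> = real (card (B - T)) * (M / r)" by simp
    also have "\<dots> \<le> real q * (M / r)"
    proof (rule mult_right_mono)
      have "card (B - T) \<le> card B" using fin[OF B(1)] by (intro card_mono) auto
      then show "real (card (B - T)) \<le> real q" using \<T>'(3)[OF B(1)] Suc.prems(5) by simp
    qed (use M r in auto)
    also have "\<dots> \<le> M * (real q / r + (\<Sum>d=1..j. (6 * real q / r) ^ d))"
      using M r by (simp add: distrib_left sum_nonneg mult.commute)
    finally show ?thesis .
  qed
  have "real (card (?U \<W>)) \<le> M * (6 * real q / r) ^ Suc j"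
  proof -
    have finW: "finite \<W>" using finT by (simp add: \<W>_def)
    have "card (?U \<W>) \<le> (\<Sum>S\<in>\<W>. deg \<A> S)" by (rule card_UN_le[OF finW])
    then have "real (card (?U \<W>)) \<le> (\<Sum>S\<in>\<W>. real (deg \<A> S))"
      unfolding of_nat_sum[symmetric] by (simp only: of_nat_le_iff)
    also have "\<dots> \<le> (\<Sum>S\<in>\<W>. M / r ^ Suc j)"
    proof (rule sum_mono)
      fix S assume "S \<in> \<W>"
      then show "real (deg \<A> S) \<le> M / r ^ Suc j"
        using deg[of S] \<T>'(1) Suc.prems(5) by (auto simp: \<W>_def)
    qed
    also have "\<dots> = real (card \<W>) * (M / r ^ Suc j)" by simp
    also have "\<dots> \<le> (6 * real q) ^ Suc j * (M / r ^ Suc j)"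
    proof (rule mult_right_mono)
      have "card \<W> \<le> (?m choose (?m - t)) * (2 * (?m - t)) ^ (?m - t)"
        unfolding \<W>_def by (rule irreducible_layer_bound[OF V \<T>'(1,2,3,5)]) auto
      then have "real (card \<W>) \<le> real ((?m choose Suc j) * (2 * Suc j) ^ Suc j)"
        by (simp only: of_nat_le_iff add_diff_cancel_left')
      also have "\<dots> \<le> (6 * real ?m) ^ Suc j" by (rule binomial_double_power_le)
      also have "\<dots> \<le> (6 * real q) ^ Suc j" using Suc.prems(5) by (intro power_mono) auto
      finally show "real (card \<W>) \<le> (6 * real q) ^ Suc j" .
    qed (use M r in auto)
    also have "\<dots> = M * (6 * real q / r) ^ Suc j" by (simp add: power_divide del: power_Suc)
    finally show ?thesis .
  qed
  then show ?case using 1 2 by (simp add: distrib_left del: power_Suc)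
qed

subsection \<open>Homogeneous approximation\<close>

lemma card_link: "card (link \<G> S) = deg \<G> S"
proof -
  have "link \<G> S = (\<lambda>A. A - S) ` containing \<G> S" by (auto simp: link_def containing_def)
  moreover have "inj_on (\<lambda>A. A - S) (containing \<G> S)"
    by (rule inj_on_inverseI[where g = "\<lambda>A. A \<union> S"]) (auto simp: containing_def)
  ultimately show ?thesis by (simp add: card_image)
qed

lemma link_link:
  assumes "X \<inter> S = {}"
  shows "link (link \<G> S) X = link \<G> (S \<union> X)"
proof -
  have 1: "A - S - X = A - (S \<union> X)" for A by auto
  have 2: "S \<subseteq> A \<and> X \<subseteq> A - S \<longleftrightarrow> S \<union> X \<subseteq> A" for A using assms by auto
  have "link (link \<G> S) X = {A - S - X |A. A \<in> \<G> \<and> S \<subseteq> A \<and> X \<subseteq> A - S}"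
    unfolding link_def by blast
  then show ?thesis unfolding 1 2 link_def .
qed

lemma link_spread_deg:
  assumes "link_spread V r p \<A>" "0 < r" "S \<subseteq> V" "card S \<le> p" "X \<inter> S = {}"
  shows "real (deg \<A> (S \<union> X)) \<le> real (deg \<A> S) / r ^ card X"
proof -
  have "real (card (link (link \<A> S) X)) \<le> r powr (- real (card X)) * real (card (link \<A> S))"
    using assms by (simp add: link_spread_def spread_def)
  then show ?thesis using assms
    by (simp add: link_link card_link powr_minus powr_realpow field_simps)
qed

text \<open>A cross-multiplied comparison of densities: passing from \<open>S\<close> to
  \<open>S \<union> X\<close> raises the density of \<open>\<G>\<close> in \<open>\<A>\<close> at
  most by the factor \<open>\<tau> ^ card X\<close>. All of \<open>\<G>\<close> is meant to lie
  above \<open>S\<close>, so \<open>card \<G>\<close> stands for its degree there.\<close>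

definition homogeneous :: "'a set \<Rightarrow> real \<Rightarrow> 'a set set \<Rightarrow> 'a set \<Rightarrow> 'a set set \<Rightarrow> bool" where
  "homogeneous V \<tau> \<A> S \<G> \<longleftrightarrow> (\<forall>X \<subseteq> V - S.
     real (deg \<G> (S \<union> X)) * real (deg \<A> S) \<le> \<tau> ^ card X * real (card \<G>) * real (deg \<A> (S \<union> X)))"

lemma deg_mono: "finite \<A> \<Longrightarrow> \<F> \<subseteq> \<A> \<Longrightarrow> deg \<F> S \<le> deg \<A> S"
  by (intro card_mono) (auto simp: containing_def)

lemma finite_containing: "finite \<A> \<Longrightarrow> finite (containing \<A> S)"
  by (simp add: containing_def)

lemma containing_containing: "containing (containing \<G> S) (S \<union> X) = containing \<G> (S \<union> X)"
  by (auto simp: containing_def)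

text \<open>Peels off the sets above an inclusion-maximal \<open>S\<close> on which \<open>\<F>\<close> has density increased by
  the factor \<open>\<tau> ^ card S\<close>; maximality is what makes the peeled part homogeneous. What is left when
  the maximal \<open>S\<close> becomes large has small density.\<close>

lemma homogeneous_approximation:
  fixes \<tau> :: real
  assumes V: "finite V" and \<A>: "finite \<A>" and \<tau>: "1 \<le> \<tau>" and \<F>: "\<F> \<subseteq> \<A>" "\<F> \<subseteq> Pow V"
  shows "\<exists>\<F>' \<S>. \<F>' \<subseteq> \<F> \<and> real (card \<F>') \<le> real (card \<A>) / \<tau> ^ q \<and> (\<forall>F\<in>\<F> - \<F>'. \<exists>S\<in>\<S>. S \<subseteq> F) \<and>
    (\<forall>S\<in>\<S>. S \<subseteq> V \<and> card S \<le> q \<and> (\<exists>\<G> \<subseteq> containing \<F> S. \<G> \<noteq> {} \<and> homogeneous V \<tau> \<A> S \<G>))"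
proof -
  have "finite \<F>" using \<F>(1) \<A> finite_subset by blast
  then show ?thesis using \<F>
  proof (induction \<F> rule: finite_psubset_induct)
    case (psubset \<F>)
    show ?case
    proof (cases "\<F> = {}")
      case True
      then show ?thesis using \<tau> by - (rule exI[of _ "{}"], rule exI[of _ "{}"], simp)
    next
      case False
      \<comment> \<open>The condition \<open>0 < deg \<F> S\<close> guarantees that peeling removes
        something, so that the induction proceeds; the empty set is always a candidate.\<close>
      define \<P> where "\<P> = {S. S \<subseteq> V \<and> 0 < deg \<F> S \<and>
        \<tau> ^ card S * real (card \<F>) * real (deg \<A> S) \<le> real (deg \<F> S) * real (card \<A>)}"
      have cF: "0 < card \<F>" using False psubset.hyps by (simp add: card_gt_0_iff)
      have "containing \<G> {} = \<G>" for \<G> :: "'a set set" by (auto simp: containing_def)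
      then have "{} \<in> \<P>" using cF by (simp add: \<P>_def)
      moreover have "finite \<P>" using V by (auto simp: \<P>_def)
      ultimately obtain S where S: "S \<in> \<P>" "\<And>S'. S' \<in> \<P> \<Longrightarrow> S \<subseteq> S' \<Longrightarrow> S = S'"
        using finite_has_maximal[of \<P>] by auto
      have SP: "S \<subseteq> V" "0 < deg \<F> S"
        "\<tau> ^ card S * real (card \<F>) * real (deg \<A> S) \<le> real (deg \<F> S) * real (card \<A>)"
        using S(1) by (auto simp: \<P>_def)
      have finS: "finite S" using SP(1) V finite_subset by blast
      have dA: "0 < deg \<A> S" using deg_mono[OF \<A> psubset.prems(1), of S] SP(2) by linarith
      have pos: "0 < \<tau> ^ card S * real (card \<F>)" using \<tau> cF by simp
      have hom: "homogeneous V \<tau> \<A> S (containing \<F> S)"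
        unfolding homogeneous_def containing_containing
      proof (intro allI impI)
        fix X assume X: "X \<subseteq> V - S"
        show "real (deg \<F> (S \<union> X)) * real (deg \<A> S)
          \<le> \<tau> ^ card X * real (deg \<F> S) * real (deg \<A> (S \<union> X))"
        proof (cases "X = {} \<or> deg \<F> (S \<union> X) = 0")
          case True
          then show ?thesis using \<tau> by auto
        next
          case F: False
          have finX: "finite X" using X V by (meson finite_Diff finite_subset)
          have "S \<union> X \<notin> \<P>"
          proof
            assume "S \<union> X \<in> \<P>"
            from S(2)[OF this] show False using X F by auto
          qed
          then have "real (deg \<F> (S \<union> X)) * real (card \<A>)
              \<le> \<tau> ^ card (S \<union> X) * real (card \<F>) * real (deg \<A> (S \<union> X))"
            using F X SP(1) by (auto simp: \<P>_def)
          moreover have "card (S \<union> X) = card S + card X"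
            using finS finX X by (intro card_Un_disjoint) auto
          ultimately have 1: "real (deg \<F> (S \<union> X)) * real (card \<A>)
              \<le> \<tau> ^ card S * \<tau> ^ card X * real (card \<F>) * real (deg \<A> (S \<union> X))"
            by (simp add: power_add)
          \<comment> \<open>The density lower bound at \<open>S\<close> and the upper bound at the
            non-candidate \<open>S \<union> X\<close> are multiplied; the common factor
            \<open>\<tau> ^ card S * card \<F>\<close> then cancels.\<close>
          have "(\<tau> ^ card S * real (card \<F>)) * (real (deg \<F> (S \<union> X)) * real (deg \<A> S))
              = real (deg \<F> (S \<union> X)) * (\<tau> ^ card S * real (card \<F>) * real (deg \<A> S))" by simp
          also have "\<dots> \<le> real (deg \<F> (S \<union> X)) * (real (deg \<F> S) * real (card \<A>))"
            using SP(3) by (intro mult_left_mono) auto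
          also have "\<dots> = (real (deg \<F> (S \<union> X)) * real (card \<A>)) * real (deg \<F> S)" by simp
          also have "\<dots> \<le> (\<tau> ^ card S * \<tau> ^ card X * real (card \<F>) * real (deg \<A> (S \<union> X))) * real (deg \<F> S)"
            using 1 by (intro mult_right_mono) auto
          also have "\<dots> = (\<tau> ^ card S * real (card \<F>)) * (\<tau> ^ card X * real (deg \<F> S) * real (deg \<A> (S \<union> X)))"
            by simp
          finally show ?thesis by (rule mult_left_le_imp_le[OF _ pos])
        qed
      qed
      show ?thesis
      proof (cases "card S \<le> q")
        case False
        \<comment> \<open>A density is at most 1, so an increment by more than \<open>q\<close>
          factors \<open>\<tau>\<close> forces all of \<open>\<F>\<close> to be small; it becomes
          the remainder.\<close>
        have "\<tau> ^ q * real (card \<F>) * real (deg \<A> S) \<le> \<tau> ^ card S * real (card \<F>) * real (deg \<A> S)"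
          using False \<tau> by (intro mult_right_mono power_increasing) auto
        also have "\<dots> \<le> real (deg \<F> S) * real (card \<A>)" by (rule SP(3))
        also have "\<dots> \<le> real (deg \<A> S) * real (card \<A>)"
          using deg_mono[OF \<A> psubset.prems(1), of S] by (intro mult_right_mono) auto
        finally have "real (deg \<A> S) * (\<tau> ^ q * real (card \<F>)) \<le> real (deg \<A> S) * real (card \<A>)"
          by (simp add: mult.commute)
        then have "\<tau> ^ q * real (card \<F>) \<le> real (card \<A>)"
          by (rule mult_left_le_imp_le) (use dA in simp)
        then have "real (card \<F>) \<le> real (card \<A>) / \<tau> ^ q" using \<tau> by (simp add: field_simps)
        then show ?thesis by - (rule exI[of _ \<F>], rule exI[of _ "{}"], simp)
      next
        case True
        let ?\<G> = "containing \<F> S"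
        have Gne: "?\<G> \<noteq> {}" using SP(2) by auto
        then have "\<F> - ?\<G> \<subset> \<F>" by (auto simp: containing_def)
        then have "\<exists>\<F>' \<S>. \<F>' \<subseteq> \<F> - ?\<G> \<and> real (card \<F>') \<le> real (card \<A>) / \<tau> ^ q \<and>
            (\<forall>F\<in>\<F> - ?\<G> - \<F>'. \<exists>S\<in>\<S>. S \<subseteq> F) \<and>
            (\<forall>S'\<in>\<S>. S' \<subseteq> V \<and> card S' \<le> q \<and>
              (\<exists>\<G> \<subseteq> containing (\<F> - ?\<G>) S'. \<G> \<noteq> {} \<and> homogeneous V \<tau> \<A> S' \<G>))"
          by (rule psubset.IH) (use psubset.prems in auto)
        then obtain \<F>' \<S> where IH: "\<F>' \<subseteq> \<F> - ?\<G>"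
          "real (card \<F>') \<le> real (card \<A>) / \<tau> ^ q" "\<forall>F\<in>\<F> - ?\<G> - \<F>'. \<exists>S\<in>\<S>. S \<subseteq> F"
          "\<forall>S'\<in>\<S>. S' \<subseteq> V \<and> card S' \<le> q \<and>
            (\<exists>\<G> \<subseteq> containing (\<F> - ?\<G>) S'. \<G> \<noteq> {} \<and> homogeneous V \<tau> \<A> S' \<G>)"
          by (elim exE conjE) (rule that)
        have sub: "containing (\<F> - ?\<G>) S' \<subseteq> containing \<F> S'" for S' by (auto simp: containing_def)
        show ?thesis
        proof (rule exI[of _ \<F>'], rule exI[of _ "insert S \<S>"], intro conjI ballI)
          show "\<F>' \<subseteq> \<F>" using IH(1) by auto
          show "real (card \<F>') \<le> real (card \<A>) / \<tau> ^ q" by (rule IH(2))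
          show "\<exists>S'\<in>insert S \<S>. S' \<subseteq> F" if "F \<in> \<F> - \<F>'" for F
          proof (cases "F \<in> ?\<G>")
            case True
            then show ?thesis by (simp add: containing_def)
          next
            case False
            then show ?thesis using that IH(3) by simp
          qed
          fix S' assume S': "S' \<in> insert S \<S>"
          show "S' \<subseteq> V" "card S' \<le> q" using S' IH(4) SP(1) True by auto
          show "\<exists>\<G> \<subseteq> containing \<F> S'. \<G> \<noteq> {} \<and> homogeneous V \<tau> \<A> S' \<G>"
          proof (cases "S' = S")
            case True
            then show ?thesis using hom Gne by blast
          next
            case False
            then have "\<exists>\<G> \<subseteq> containing (\<F> - ?\<G>) S'. \<G> \<noteq> {} \<and> homogeneous V \<tau> \<A> S' \<G>"
              using S' IH(4) by blast
            then show ?thesis using sub by (meson subset_trans)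
          qed
        qed
      qed
    qed
  qed
qed

subsection \<open>Intersections of the supports\<close>

lemma shadow_link_eq:
  assumes "\<A> \<subseteq> nsets V k"
  shows "shadow l (link \<A> S) = {H \<in> nsets V l. H \<inter> S = {} \<and> containing \<A> (S \<union> H) \<noteq> {}}"
    (is "?L = ?R")
proof
  show "?L \<subseteq> ?R"
  proof
    fix H assume "H \<in> ?L"
    then obtain A where "A \<in> \<A>" "S \<subseteq> A" "H \<subseteq> A - S" "finite H" "card H = l"
      by (auto simp: shadow_def link_def nsets_def)
    moreover then have "A \<subseteq> V" using assms by (auto simp: nsets_def)
    ultimately show "H \<in> ?R" by (auto simp: nsets_def containing_def)
  qed
  show "?R \<subseteq> ?L"
  proof
    fix H assume "H \<in> ?R"
    then obtain A where A: "A \<in> \<A>" "S \<union> H \<subseteq> A" "H \<inter> S = {}" "finite H" "card H = l"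
      by (auto simp: nsets_def containing_def)
    then have "A - S \<in> link \<A> S" "H \<in> nsets (A - S) l" by (auto simp: link_def nsets_def)
    then show "H \<in> ?L" by (auto simp: shadow_def)
  qed
qed

text \<open>Double counting of pairs \<open>H \<subseteq> F - S\<close> with \<open>F\<close> in
  \<open>\<G>\<close>. All \<open>l\<close>-subsets of \<open>F - S\<close> lie in the shadow,
  because \<open>F\<close> belongs to \<open>\<A>\<close>.\<close>

lemma sum_deg_shadow:
  assumes V: "finite V" and \<A>: "\<A> \<subseteq> nsets V k" and \<G>: "\<G> \<subseteq> containing \<A> S"
  shows "(\<Sum>H\<in>shadow l (link \<A> S). deg \<G> (S \<union> H)) = ((k - card S) choose l) * card \<G>"
proof -
  let ?P = "shadow l (link \<A> S)"
  have fin: "finite ?P" using V by (simp add: shadow_link_eq[OF \<A>] finite_imp_finite_nsets)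
  have "finite \<A>" using \<A> V by (rule finite_subset[OF _ finite_imp_finite_nsets])
  then have finG: "finite \<G>" using \<G> finite_containing by (metis finite_subset)
  have *: "containing \<G> (S \<union> H) = {F \<in> \<G>. H \<subseteq> F}" for H using \<G> by (auto simp: containing_def)
  have "card {H \<in> ?P. H \<subseteq> F} = (k - card S) choose l" if F: "F \<in> \<G>" for F
  proof -
    have F': "F \<in> \<A>" "S \<subseteq> F" using F \<G> by (auto simp: containing_def)
    then have "F \<subseteq> V" "finite F" "card F = k" using \<A> by (auto simp: nsets_def)
    moreover have "{H \<in> ?P. H \<subseteq> F} = nsets (F - S) l"
      unfolding shadow_link_eq[OF \<A>] using F' \<open>F \<subseteq> V\<close> \<open>finite F\<close>
      by (auto simp: nsets_def containing_def)
    ultimately show ?thesis using F' finite_subset[of S F]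
      by (simp add: card_nsets card_Diff_subset)
  qed
  then show ?thesis
    unfolding * using fin finG by (intro sum_multicount) auto
qed

text \<open>The ratios \<open>deg \<G> (S \<union> H) / deg \<A> (S \<union> H)\<close> average to \<open>card \<G> / deg \<A> S\<close> with respect to the
  weights \<open>deg \<A> (S \<union> H)\<close> and exceed this by at most the factor \<open>\<tau> ^ l\<close>, so few of them are below
  half of it.\<close>

lemma few_sparse_extensions:
  fixes \<epsilon> \<theta> \<tau> :: real
  assumes V: "finite V" and \<A>: "\<A> \<subseteq> nsets V k" and \<G>: "\<G> \<subseteq> containing \<A> S" "\<G> \<noteq> {}"
    and hom: "homogeneous V \<tau> \<A> S \<G>" and \<tau>: "1 \<le> \<tau>" "\<tau> ^ l \<le> 1 + 1.01 * (\<epsilon> * \<theta>)"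
    and \<epsilon>: "0 < \<epsilon>" "0 < \<theta>"
    and P: "P = shadow l (link \<A> S)" "P \<noteq> {}"
    and reg: "(1 - \<epsilon>) * real (card P)
      \<le> real (card {H \<in> P. \<theta> * ((\<Sum>H\<in>P. real (deg \<A> (S \<union> H))) / real (card P)) \<le> real (deg \<A> (S \<union> H))})"
  shows "real (card {H \<in> P. 2 * real (deg \<G> (S \<union> H)) * real (deg \<A> S)
      < real (card \<G>) * real (deg \<A> (S \<union> H))}) \<le> 3.1 * \<epsilon> * real (card P)"
proof -
  define B where "B = {H \<in> P. 2 * real (deg \<G> (S \<union> H)) * real (deg \<A> S)
      < real (card \<G>) * real (deg \<A> (S \<union> H))}"
  define N where "N = real ((k - card S) choose l)"
  define D where "D = {H \<in> P. \<theta> * ((\<Sum>H\<in>P. real (deg \<A> (S \<union> H))) / real (card P)) \<le> real (deg \<A> (S \<union> H))}"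
  define a where "a = real (deg \<A> S)"
  define g where "g = real (card \<G>)"
  define x where "x = \<tau> ^ l"
  have finA: "finite \<A>" using \<A> V by (rule finite_subset[OF _ finite_imp_finite_nsets])
  have finG: "finite \<G>" using \<G>(1) finite_containing[OF finA] by (rule finite_subset)
  have finP: "finite P" unfolding P using V by (simp add: shadow_link_eq[OF \<A>] finite_imp_finite_nsets)
  have g0: "0 < g" using finG \<G>(2) by (simp add: g_def card_gt_0_iff)
  have "card \<G> \<le> deg \<A> S" using \<G>(1) finite_containing[OF finA] by (rule card_mono[rotated])
  then have a0: "0 < a" using g0 by (simp add: a_def g_def)
  have x1: "1 \<le> x" using \<tau> by (simp add: x_def one_le_power)
  have cP: "0 < real (card P)" using finP P(2) by (simp add: card_gt_0_iff)
  have sumA: "(\<Sum>H\<in>P. real (deg \<A> (S \<union> H))) = N * a"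
  proof -
    have "(\<Sum>H\<in>P. deg (containing \<A> S) (S \<union> H)) = ((k - card S) choose l) * deg \<A> S"
      unfolding P by (rule sum_deg_shadow[OF V \<A>]) simp
    then show ?thesis unfolding containing_containing N_def a_def
      by (metis (no_types, lifting) of_nat_mult of_nat_sum sum.cong)
  qed
  have sumG: "(\<Sum>H\<in>P. real (deg \<G> (S \<union> H))) = N * g"
    using sum_deg_shadow[OF V \<A> \<G>(1), of l] unfolding P N_def g_def
    by (metis (no_types, lifting) of_nat_mult of_nat_sum sum.cong)
  have pos: "0 < real (deg \<A> (S \<union> H))" if "H \<in> P" for H
    using that finite_containing[OF finA] unfolding P shadow_link_eq[OF \<A>] by (simp add: card_gt_0_iff)
  have Na: "0 < N * a" unfolding sumA[symmetric] using finP P(2) pos by (intro sum_pos) auto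
  define w where "w = (\<Sum>H\<in>B. real (deg \<A> (S \<union> H)))"
  have BP: "B \<subseteq> P" by (auto simp: B_def)
  have finB: "finite B" using BP finP by (rule finite_subset)
  have split: "sum f P = sum f B + sum f (P - B)" for f :: "'a set \<Rightarrow> real"
    using sum.subset_diff[OF BP finP, of f] by simp
  have upper: "real (deg \<G> (S \<union> H)) * a \<le> x * g * real (deg \<A> (S \<union> H))" if "H \<in> P" for H
  proof -
    have "H \<subseteq> V - S" "card H = l" using that unfolding P shadow_link_eq[OF \<A>] by (auto simp: nsets_def)
    then show ?thesis using hom by (auto simp: homogeneous_def a_def g_def x_def)
  qed
  \<comment> \<open>The mass of \<open>\<G>\<close> is split: sparse sets \<open>H\<close> carry at
    most half of their proportional share, the others at most \<open>x\<close> times theirs. With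
    \<open>x\<close> close to 1 this leaves little weight \<open>w\<close> for
    \<open>B\<close>.\<close>
  have "N * g * a = (\<Sum>H\<in>P. real (deg \<G> (S \<union> H)) * a)"
    by (simp add: sumG[symmetric] sum_distrib_right)
  also have "\<dots> = (\<Sum>H\<in>B. real (deg \<G> (S \<union> H)) * a) + (\<Sum>H\<in>P - B. real (deg \<G> (S \<union> H)) * a)"
    by (rule split)
  also have "\<dots> \<le> (\<Sum>H\<in>B. g / 2 * real (deg \<A> (S \<union> H))) + (\<Sum>H\<in>P - B. x * g * real (deg \<A> (S \<union> H)))"
    using upper by (intro add_mono sum_mono) (auto simp: B_def a_def g_def)
  also have "\<dots> = g / 2 * w + x * g * (N * a - w)"
  proof -
    have "(\<Sum>H\<in>P - B. real (deg \<A> (S \<union> H))) = N * a - w"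
      using split[of "\<lambda>H. real (deg \<A> (S \<union> H))"] sumA by (simp add: w_def)
    then show ?thesis unfolding w_def by (simp only: sum_distrib_left[symmetric])
  qed
  finally have "g * (N * a) \<le> g * (w / 2 + x * (N * a - w))" by (simp add: algebra_simps)
  then have "N * a \<le> w / 2 + x * (N * a - w)" using g0 by simp
  then have 1: "(x - 1 / 2) * w \<le> (x - 1) * (N * a)" by (simp add: algebra_simps)
  have w0: "0 \<le> w" by (simp add: w_def sum_nonneg)
  have "1 / 2 * w \<le> (x - 1 / 2) * w" using x1 w0 by (intro mult_right_mono) auto
  also note 1
  also have "(x - 1) * (N * a) \<le> 1.01 * (\<epsilon> * \<theta>) * (N * a)"
    using \<tau>(2) Na by (intro mult_right_mono) (auto simp: x_def)
  finally have w: "w \<le> 2.02 * (\<epsilon> * \<theta>) * (N * a)" by simp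
  \<comment> \<open>Small weight becomes small cardinality on \<open>D\<close>, where every degree
    is at least \<open>\<theta>\<close> times the average. Outside \<open>D\<close> lie at most
    \<open>\<epsilon> * card P\<close> sets by regularity.\<close>
  have "real (card (B \<inter> D)) * (\<theta> * (N * a / real (card P))) = (\<Sum>H\<in>B \<inter> D. \<theta> * (N * a / real (card P)))"
    by simp
  also have "\<dots> \<le> (\<Sum>H\<in>B \<inter> D. real (deg \<A> (S \<union> H)))"
    by (rule sum_mono) (auto simp: D_def sumA)
  also have "\<dots> \<le> w" unfolding w_def using finB by (intro sum_mono2) auto
  also note w
  finally have "(\<theta> * (N * a)) * (real (card (B \<inter> D)) / real (card P)) \<le> (\<theta> * (N * a)) * (2.02 * \<epsilon>)"
    by (simp add: mult_ac)
  then have "real (card (B \<inter> D)) / real (card P) \<le> 2.02 * \<epsilon>"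
    by (rule mult_left_le_imp_le) (use Na \<epsilon> in simp)
  then have BD: "real (card (B \<inter> D)) \<le> 2.02 * \<epsilon> * real (card P)" using cP by (simp add: field_simps)
  have DP: "D \<subseteq> P" by (auto simp: D_def)
  have "real (card (P - D)) = real (card P) - real (card D)"
    using card_Diff_subset[OF finite_subset[OF DP finP] DP] card_mono[OF finP DP] by simp
  also have "\<dots> \<le> \<epsilon> * real (card P)" using reg unfolding D_def[symmetric] by (simp add: algebra_simps)
  finally have PD: "real (card (P - D)) \<le> \<epsilon> * real (card P)" .
  have "card B \<le> card ((B \<inter> D) \<union> (P - D))" using BP finP finB by (intro card_mono) auto
  also have "\<dots> \<le> card (B \<inter> D) + card (P - D)" by (rule card_Un_le)
  finally have "real (card B) \<le> real (card (B \<inter> D)) + real (card (P - D))" by linarith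
  also have "\<dots> \<le> 3.02 * \<epsilon> * real (card P)" using BD PD by (simp add: algebra_simps)
  also have "\<dots> \<le> 3.1 * \<epsilon> * real (card P)" using cP \<epsilon> by (intro mult_right_mono) auto
  finally show ?thesis by (simp add: B_def)
qed

text \<open>Spreadness of \<open>\<A>\<close> above \<open>S \<union> H\<close> passes to
  \<open>\<G>\<close> by homogeneity, with a factor 2 lost because \<open>\<G>\<close> keeps at
  least half of its density there. Removing the members that meet the forbidden set \<open>Y\<close>
  costs few of them, since \<open>card Y\<close> is small against \<open>r\<close>.\<close>

lemma homogeneous_extension_spread:
  fixes r \<tau> :: real
  assumes V: "finite V" and \<A>: "\<A> \<subseteq> nsets V k" and \<G>: "\<G> \<subseteq> containing \<A> S" "\<G> \<noteq> {}"
    and hom: "homogeneous V \<tau> \<A> S \<G>" and \<tau>: "1 \<le> \<tau>" "\<tau> \<le> 1.02" "\<tau> ^ l \<le> 1.02"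
    and H: "H \<in> nsets V l" "H \<inter> S = {}" "containing \<A> (S \<union> H) \<noteq> {}"
      "real (card \<G>) * real (deg \<A> (S \<union> H)) \<le> 2 * real (deg \<G> (S \<union> H)) * real (deg \<A> S)"
    and r: "0 < r" "100 * real q \<le> r"
    and sp: "\<And>X. X \<inter> (S \<union> H) = {} \<Longrightarrow> real (deg \<A> (S \<union> H \<union> X)) \<le> real (deg \<A> (S \<union> H)) / r ^ card X"
    and Y: "Y \<subseteq> V" "Y \<inter> (S \<union> H) = {}" "card Y \<le> q"
    and \<G>': "\<G>' = {F \<in> containing \<G> (S \<union> H). F \<inter> Y = {}}"
  shows "\<G>' \<noteq> {}"
    and "\<And>X. X \<subseteq> V \<Longrightarrow> real (card {F \<in> \<G>'. X \<subseteq> F - (S \<union> H)}) \<le> real (card \<G>') / (r / 4) ^ card X"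
proof -
  define Z where "Z = S \<union> H"
  define z where "z = real (deg \<G> Z)"
  have finA: "finite \<A>" using \<A> V by (rule finite_subset[OF _ finite_imp_finite_nsets])
  have finG: "finite \<G>" using \<G>(1) finite_containing[OF finA] by (rule finite_subset)
  have g0: "0 < real (card \<G>)" using finG \<G>(2) by (simp add: card_gt_0_iff)
  have "card \<G> \<le> deg \<A> S" using \<G>(1) finite_containing[OF finA] by (rule card_mono[rotated])
  then have a0: "0 < real (deg \<A> S)" using g0 by simp
  have "0 < real (deg \<A> Z)" using H(3) finite_containing[OF finA] by (simp add: Z_def card_gt_0_iff)
  then have "0 < 2 * z * real (deg \<A> S)"
    using H(4) g0 unfolding Z_def z_def by (smt (verit) mult_pos_pos)
  then have z0: "0 < z" using a0 by (simp add: zero_less_mult_iff)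
  have finH: "finite H" "card H = l" using H(1) by (auto simp: nsets_def)
  have 1: "real (deg \<G> (Z \<union> X)) \<le> (3 / r) ^ card X * z" if X: "X \<subseteq> V - Z" "X \<noteq> {}" for X
  proof -
    have finX: "finite X" using X V by (meson finite_Diff finite_subset)
    have HX: "card (H \<union> X) = l + card X" using finX finH X by (subst card_Un_disjoint) (auto simp: Z_def)
    have j: "1 \<le> card X" using finX X by (simp add: Suc_leI card_gt_0_iff)
    have eq: "S \<union> (H \<union> X) = Z \<union> X" by (auto simp: Z_def)
    \<comment> \<open>The constants are absorbed into one factor 3 per element: \<open>X\<close> is
      nonempty and \<open>2.04 * 1.02 < 3\<close>.\<close>
    have num: "2 * \<tau> ^ (l + card X) \<le> 3 ^ card X"
    proof -
      have "2 * \<tau> ^ (l + card X) = 2 * \<tau> ^ l * \<tau> ^ card X" by (simp add: power_add)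
      also have "\<dots> \<le> 2.04 * 1.02 ^ card X"
        using \<tau> by (intro mult_mono power_mono) auto
      also have "\<dots> \<le> 2.04 ^ card X * 1.02 ^ card X"
        using self_le_power[OF _ , of "2.04::real" "card X"] j by (intro mult_right_mono) auto
      also have "\<dots> = (2.04 * 1.02) ^ card X" by (simp only: power_mult_distrib)
      also have "\<dots> \<le> 3 ^ card X" by (intro power_mono) auto
      finally show ?thesis .
    qed
    have "real (deg \<G> (Z \<union> X)) * real (deg \<A> S)
        \<le> \<tau> ^ (l + card X) * real (card \<G>) * real (deg \<A> (Z \<union> X))"
      using hom[unfolded homogeneous_def, rule_format, of "H \<union> X"] H(1,2) X eq HX
      by (auto simp: nsets_def Z_def)
    also have "\<dots> \<le> \<tau> ^ (l + card X) * real (card \<G>) * (real (deg \<A> Z) / r ^ card X)"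
      using sp[of X] X \<tau> unfolding Z_def by (intro mult_left_mono) auto
    also have "\<dots> = \<tau> ^ (l + card X) / r ^ card X * (real (card \<G>) * real (deg \<A> Z))" by simp
    also have "\<dots> \<le> \<tau> ^ (l + card X) / r ^ card X * (2 * z * real (deg \<A> S))"
      using H(4) \<tau> r by (intro mult_left_mono) (auto simp: Z_def z_def)
    also have "\<dots> = (2 * \<tau> ^ (l + card X)) * (z / r ^ card X * real (deg \<A> S))" by simp
    also have "\<dots> \<le> 3 ^ card X * (z / r ^ card X * real (deg \<A> S))"
      using num z0 r by (intro mult_right_mono) auto
    also have "\<dots> = (3 / r) ^ card X * z * real (deg \<A> S)" by (simp add: power_divide)
    finally show ?thesis by (rule mult_right_le_imp_le) (rule a0)
  qed
  have finG': "finite \<G>'" unfolding \<G>' using finite_containing[OF finG] by simp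
  have finY: "finite Y" using Y(1) V by (rule finite_subset)
  have 2: "97 / 100 * z \<le> real (card \<G>')"
  proof -
    have "containing \<G> Z \<subseteq> \<G>' \<union> (\<Union>y\<in>Y. containing \<G> (Z \<union> {y}))"
      unfolding \<G>' Z_def[symmetric] by (auto simp: containing_def)
    then have "deg \<G> Z \<le> card (\<G>' \<union> (\<Union>y\<in>Y. containing \<G> (Z \<union> {y})))"
      using finG' finY finite_containing[OF finG] by (intro card_mono) auto
    also have "\<dots> \<le> card \<G>' + card (\<Union>y\<in>Y. containing \<G> (Z \<union> {y}))" by (rule card_Un_le)
    also have "card (\<Union>y\<in>Y. containing \<G> (Z \<union> {y})) \<le> (\<Sum>y\<in>Y. deg \<G> (Z \<union> {y}))"
      by (rule card_UN_le[OF finY])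
    finally have "z \<le> real (card \<G>' + (\<Sum>y\<in>Y. deg \<G> (Z \<union> {y})))"
      unfolding z_def by (simp only: of_nat_le_iff add_le_mono)
    also have "\<dots> = real (card \<G>') + (\<Sum>y\<in>Y. real (deg \<G> (Z \<union> {y})))" by (simp only: of_nat_add of_nat_sum)
    also have "(\<Sum>y\<in>Y. real (deg \<G> (Z \<union> {y}))) \<le> (\<Sum>y\<in>Y. 3 / r * z)"
    proof (rule sum_mono)
      fix y assume "y \<in> Y"
      then show "real (deg \<G> (Z \<union> {y})) \<le> 3 / r * z"
        using 1[of "{y}"] Y unfolding Z_def[symmetric] by auto
    qed
    also have "\<dots> = real (card Y) * (3 / r) * z" by simp
    also have "\<dots> \<le> 3 / 100 * z"
    proof (rule mult_right_mono)
      have "real (card Y) * 3 \<le> 3 / 100 * r" using Y(3) r(2) by simp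
      then show "real (card Y) * (3 / r) \<le> 3 / 100" using r(1) by (simp add: field_simps)
    qed (use z0 in simp)
    finally show ?thesis by simp
  qed
  then have "0 < real (card \<G>')" using z0 by linarith
  then show "\<G>' \<noteq> {}" by auto
  fix X assume X: "X \<subseteq> V"
  show "real (card {F \<in> \<G>'. X \<subseteq> F - (S \<union> H)}) \<le> real (card \<G>') / (r / 4) ^ card X"
  proof (cases "X = {} \<or> X \<inter> Z \<noteq> {}")
    case True
    then show ?thesis
    proof
      assume "X \<inter> Z \<noteq> {}"
      then have "{F \<in> \<G>'. X \<subseteq> F - (S \<union> H)} = {}" by (auto simp: Z_def)
      then show ?thesis using r by (simp only: card.empty) simp
    qed simp
  next
    case False
    have finX: "finite X" using X V by (rule finite_subset)
    have j: "1 \<le> card X" using finX False by (simp add: Suc_leI card_gt_0_iff)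
    have "card {F \<in> \<G>'. X \<subseteq> F - (S \<union> H)} \<le> deg \<G> (Z \<union> X)"
      unfolding \<G>' by (intro card_mono finite_containing[OF finG]) (auto simp: containing_def Z_def)
    then have "real (card {F \<in> \<G>'. X \<subseteq> F - (S \<union> H)}) \<le> (3 / r) ^ card X * z"
      using 1[of X] X False by fastforce
    also have "\<dots> \<le> (3 / r) ^ card X * ((4 / 3) ^ card X * real (card \<G>'))"
    proof (rule mult_left_mono)
      \<comment> \<open>The loss from avoiding \<open>Y\<close> is likewise charged to each element
        of \<open>X\<close>, turning \<open>3 / r\<close> into \<open>4 / r\<close>.\<close>
      have "z \<le> 4 / 3 * real (card \<G>')" using 2 z0 by linarith
      also have "\<dots> \<le> (4 / 3) ^ card X * real (card \<G>')"
        using self_le_power[OF _ , of "4 / 3::real" "card X"] j by (intro mult_right_mono) auto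
      finally show "z \<le> (4 / 3) ^ card X * real (card \<G>')" .
    qed (use r in simp)
    also have "\<dots> = (3 / r * (4 / 3)) ^ card X * real (card \<G>')" by (simp only: power_mult_distrib mult.assoc)
    also have "\<dots> = real (card \<G>') / (r / 4) ^ card X" by (simp add: power_divide)
    finally show ?thesis .
  qed
qed

text \<open>Turns probability and expectation into counting. The second part assumes a nonempty
  shadow, as \<open>pmf_of_set\<close> is unspecified on the empty set.\<close>

lemma regular_familyD:
  assumes V: "finite V" and \<A>: "\<A> \<subseteq> nsets V k" and reg: "regular_family t q \<epsilon> \<theta> \<A>"
    and l: "l \<le> t" and S: "card S \<le> q" "containing \<A> S \<noteq> {}"
  shows "(1 - \<epsilon>) * real (card (shadow l \<A>)) \<le> real (card (shadow l (link \<A> S)))"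
    and "shadow l (link \<A> S) \<noteq> {} \<Longrightarrow> P = shadow l (link \<A> S) \<Longrightarrow> (1 - \<epsilon>) * real (card P)
      \<le> real (card {H \<in> P. \<theta> * ((\<Sum>H\<in>P. real (deg \<A> (S \<union> H))) / real (card P)) \<le> real (deg \<A> (S \<union> H))})"
proof -
  obtain A where A: "A \<in> \<A>" "S \<subseteq> A" using S(2) by (auto simp: containing_def)
  then have "finite A" using \<A> by (auto simp: nsets_def)
  then have "S \<in> nsets A (card S)" using A(2) finite_subset by (auto simp: nsets_def)
  then have "S \<in> shadow_upto q \<A>" using A(1) S(1) by (auto simp: shadow_upto_def shadow_def)
  note R = reg[unfolded regular_family_def Let_def card_link, rule_format, OF l this]
  show "(1 - \<epsilon>) * real (card (shadow l \<A>)) \<le> real (card (shadow l (link \<A> S)))" using R by simp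
  assume ne: "shadow l (link \<A> S) \<noteq> {}" and P: "P = shadow l (link \<A> S)"
  have fin: "finite P" unfolding P using V by (simp add: shadow_link_eq[OF \<A>] finite_imp_finite_nsets)
  have c0: "0 < real (card P)" using ne fin P by (simp add: card_gt_0_iff)
  let ?D = "{H. \<theta> * ((\<Sum>H\<in>P. real (deg \<A> (S \<union> H))) / real (card P)) \<le> real (deg \<A> (S \<union> H))}"
  have "1 - \<epsilon> \<le> real (card (P \<inter> ?D)) / real (card P)"
    using R ne fin unfolding P[symmetric] by (simp add: integral_pmf_of_set measure_pmf_of_set)
  moreover have "P \<inter> ?D = {H \<in> P. \<theta> * ((\<Sum>H\<in>P. real (deg \<A> (S \<union> H))) / real (card P)) \<le> real (deg \<A> (S \<union> H))}"
    by auto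
  ultimately show "(1 - \<epsilon>) * real (card P)
      \<le> real (card {H \<in> P. \<theta> * ((\<Sum>H\<in>P. real (deg \<A> (S \<union> H))) / real (card P)) \<le> real (deg \<A> (S \<union> H))})"
    using c0 by (simp add: field_simps)
qed

text \<open>Supports with too small an intersection are extended by a common \<open>H\<close> to
  reach \<open>t - 1\<close> common elements; disjoint members of the two links then violate the
  forbidden intersection. The bound \<open>K \<ge> 2\<close> on the member size keeps the logarithm
  positive even for \<open>k = 1\<close>.\<close>

lemma homogeneous_supports_intersect:
  fixes r \<epsilon> \<theta> :: real
  assumes V: "finite V" and \<A>: "\<A> \<subseteq> nsets V k" and t: "1 \<le> t" "t \<le> k" "t \<le> q"
    and \<epsilon>: "0 < \<epsilon>" "\<epsilon> \<le> 0.01" and \<theta>: "0 < \<theta>" "\<theta> \<le> 1"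
    and r: "0 < r" "100 * real q \<le> r" "2 ^ 15 * ln (real K) \<le> r" and K: "2 \<le> K" "k \<le> K"
    and reg: "regular_family t q \<epsilon> \<theta> \<A>" and sp: "link_spread V r (2 * q) \<A>"
    and avoid: "\<And>F F'. F \<in> \<F> \<Longrightarrow> F' \<in> \<F> \<Longrightarrow> card (F \<inter> F') \<noteq> t - 1" and \<F>: "\<F> \<subseteq> \<A>"
    and \<tau>: "\<tau> = exp (\<epsilon> * \<theta> / real t)"
    and S: "S1 \<subseteq> V" "card S1 \<le> q" "S2 \<subseteq> V" "card S2 \<le> q"
    and \<G>1: "\<G>1 \<subseteq> containing \<F> S1" "\<G>1 \<noteq> {}" "homogeneous V \<tau> \<A> S1 \<G>1"
    and \<G>2: "\<G>2 \<subseteq> containing \<F> S2" "\<G>2 \<noteq> {}" "homogeneous V \<tau> \<A> S2 \<G>2"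
  shows "t \<le> card (S1 \<inter> S2)"
proof (rule ccontr)
  assume "\<not> ?thesis"
  then have lt: "card (S1 \<inter> S2) < t" by simp
  define l where "l = t - 1 - card (S1 \<inter> S2)"
  have lt': "l \<le> t" by (simp add: l_def)
  have \<epsilon>\<theta>: "0 < \<epsilon> * \<theta>" "\<epsilon> * \<theta> \<le> 1 / 100"
    using \<epsilon> \<theta> mult_mono[of \<epsilon> "1 / 100" \<theta> 1] by auto
  have \<tau>1: "1 \<le> \<tau>" using \<tau> \<epsilon>\<theta> by simp
  have \<tau>pow: "\<tau> ^ j \<le> 1 + 1.01 * (\<epsilon> * \<theta>)" if "j \<le> t" for j
  proof -
    have "\<tau> ^ j \<le> \<tau> ^ t" using that \<tau>1 by (rule power_increasing)
    also have "\<dots> = exp (\<epsilon> * \<theta>)" using t by (simp add: \<tau> exp_of_nat_mult[symmetric])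
    also have "\<dots> \<le> 1 + \<epsilon> * \<theta> + (\<epsilon> * \<theta>)\<^sup>2" using \<epsilon>\<theta> by (intro exp_bound) auto
    also have "(\<epsilon> * \<theta>)\<^sup>2 \<le> 1 / 100 * (\<epsilon> * \<theta>)"
      unfolding power2_eq_square using \<epsilon>\<theta> by (intro mult_right_mono) auto
    finally show ?thesis by simp
  qed
  have \<tau>l: "\<tau> ^ l \<le> 1 + 1.01 * (\<epsilon> * \<theta>)" by (rule \<tau>pow[OF lt'])
  have \<tau>102: "\<tau> \<le> 1.02" "\<tau> ^ l \<le> 1.02" using \<tau>l \<tau>pow[of 1] t \<epsilon>\<theta> by auto
  have cont: "containing \<F> S \<subseteq> containing \<A> S" for S using \<F> by (auto simp: containing_def)
  have \<G>1': "\<G>1 \<subseteq> containing \<A> S1" and \<G>2': "\<G>2 \<subseteq> containing \<A> S2"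
    using \<G>1(1) \<G>2(1) cont by blast+
  define Q where "Q = shadow l \<A>"
  define good where "good S \<G> = {H \<in> shadow l (link \<A> S).
    real (card \<G>) * real (deg \<A> (S \<union> H)) \<le> 2 * real (deg \<G> (S \<union> H)) * real (deg \<A> S)}" for S \<G>
  obtain A where A: "A \<in> \<A>" using \<G>1(2) \<G>1' by (auto simp: containing_def)
  have Qsub: "Q \<subseteq> nsets V l" using \<A> by (auto simp: Q_def shadow_def nsets_def)
  then have finQ: "finite Q" using V finite_imp_finite_nsets finite_subset by metis
  have "card A = k" "finite A" using A \<A> by (auto simp: nsets_def)
  then obtain H0 where "H0 \<subseteq> A" "card H0 = l" "finite H0"
    using obtain_subset_with_card_n[of l A] lt' t(2) by (metis le_trans)
  then have "H0 \<in> Q" using A by (auto simp: Q_def shadow_def nsets_def)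
  then have cQ: "0 < real (card Q)" using finQ by (auto simp: card_gt_0_iff)
  \<comment> \<open>Each good set fills more than half of the common shadow \<open>Q\<close>, so the
    two good sets share an \<open>H\<close>.\<close>
  have good_bound: "good S \<G> \<subseteq> Q \<and> 0.9 * real (card Q) \<le> real (card (good S \<G>))"
    if S: "card S \<le> q" and \<G>: "\<G> \<subseteq> containing \<A> S" "\<G> \<noteq> {}" "homogeneous V \<tau> \<A> S \<G>" for S \<G>
  proof -
    define P where "P = shadow l (link \<A> S)"
    have PQ: "P \<subseteq> Q" by (auto simp: P_def Q_def shadow_def link_def nsets_def)
    have finP: "finite P" using PQ finQ by (rule finite_subset)
    have ne: "containing \<A> S \<noteq> {}" using \<G> by blast
    have "99 / 100 * real (card Q) \<le> (1 - \<epsilon>) * real (card Q)"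
      using \<epsilon> by (intro mult_right_mono) auto
    also have "\<dots> \<le> real (card P)"
      unfolding P_def Q_def by (rule regular_familyD(1)[OF V \<A> reg lt' S ne])
    finally have cP: "99 / 100 * real (card Q) \<le> real (card P)" .
    then have Pne: "P \<noteq> {}" using cQ by auto
    let ?B = "{H \<in> P. 2 * real (deg \<G> (S \<union> H)) * real (deg \<A> S) < real (card \<G>) * real (deg \<A> (S \<union> H))}"
    have "real (card ?B) \<le> 3.1 * \<epsilon> * real (card P)"
      using few_sparse_extensions[OF V \<A> \<G> \<tau>1 \<tau>l \<epsilon>(1) \<theta>(1) P_def Pne]
        regular_familyD(2)[OF V \<A> reg lt' S ne _ P_def] Pne P_def by auto
    also have "\<dots> \<le> 31 / 1000 * real (card P)" using \<epsilon> by (intro mult_right_mono) auto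
    finally have B: "real (card ?B) \<le> 31 / 1000 * real (card P)" .
    have "good S \<G> = P - ?B" by (auto simp: good_def P_def)
    then have "card (good S \<G>) = card P - card ?B" using finP by (simp add: card_Diff_subset)
    then have "real (card (good S \<G>)) \<ge> real (card P) - real (card ?B)" by linarith
    then have "real (card (good S \<G>)) \<ge> 969 / 1000 * (99 / 100 * real (card Q))" using B cP by linarith
    then show ?thesis using PQ cQ by (auto simp: good_def P_def)
  qed
  note g1 = good_bound[OF S(2) \<G>1' \<G>1(2,3)] and g2 = good_bound[OF S(4) \<G>2' \<G>2(2,3)]
  have "good S1 \<G>1 \<inter> good S2 \<G>2 \<noteq> {}"
  proof
    assume "good S1 \<G>1 \<inter> good S2 \<G>2 = {}"
    then have "card (good S1 \<G>1) + card (good S2 \<G>2) = card (good S1 \<G>1 \<union> good S2 \<G>2)"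
      using g1 g2 finQ by (metis card_Un_disjoint finite_subset)
    also have "\<dots> \<le> card Q" using g1 g2 finQ by (intro card_mono) auto
    finally have "real (card (good S1 \<G>1)) + real (card (good S2 \<G>2)) \<le> real (card Q)" by linarith
    then show False using g1 g2 cQ by simp
  qed
  then obtain H where H: "H \<in> good S1 \<G>1" "H \<in> good S2 \<G>2" by blast
  have H1: "H \<in> nsets V l" "H \<inter> S1 = {}" "containing \<A> (S1 \<union> H) \<noteq> {}"
    "real (card \<G>1) * real (deg \<A> (S1 \<union> H)) \<le> 2 * real (deg \<G>1 (S1 \<union> H)) * real (deg \<A> S1)"
    using H(1) by (auto simp: good_def shadow_link_eq[OF \<A>])
  have H2: "H \<in> nsets V l" "H \<inter> S2 = {}" "containing \<A> (S2 \<union> H) \<noteq> {}"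
    "real (card \<G>2) * real (deg \<A> (S2 \<union> H)) \<le> 2 * real (deg \<G>2 (S2 \<union> H)) * real (deg \<A> S2)"
    using H(2) by (auto simp: good_def shadow_link_eq[OF \<A>])
  have Hl: "H \<subseteq> V" "finite H" "card H = l" using H1(1) by (auto simp: nsets_def)
  have spH: "real (deg \<A> (S \<union> H \<union> X)) \<le> real (deg \<A> (S \<union> H)) / r ^ card X"
    if "S \<subseteq> V" "card S \<le> q" "X \<inter> (S \<union> H) = {}" for S X
  proof (rule link_spread_deg[OF sp r(1) _ _ that(3)])
    show "S \<union> H \<subseteq> V" using that Hl by auto
    \<comment> \<open>Spreadness beyond size \<open>q\<close> is needed here: the support is
      enlarged by up to \<open>t \<le> q\<close> elements.\<close>
    show "card (S \<union> H) \<le> 2 * q" using card_Un_le[of S H] that Hl lt' t by linarith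
  qed
  have fS: "finite S1" "finite S2" using S V finite_subset by auto
  \<comment> \<open>Members above one support must avoid the rest of the other support, so that no
    intersection arises beyond \<open>(S1 \<inter> S2) \<union> H\<close>.\<close>
  define Y1 where "Y1 = S2 - S1"
  define Y2 where "Y2 = S1 - S2"
  define \<H>1 where "\<H>1 = {F \<in> containing \<G>1 (S1 \<union> H). F \<inter> Y1 = {}}"
  define \<H>2 where "\<H>2 = {F \<in> containing \<G>2 (S2 \<union> H). F \<inter> Y2 = {}}"
  have Y1: "Y1 \<subseteq> V" "Y1 \<inter> (S1 \<union> H) = {}" "card Y1 \<le> q"
    using S(3) H2(2) card_mono[OF fS(2), of Y1] S(4) by (auto simp: Y1_def)
  have Y2: "Y2 \<subseteq> V" "Y2 \<inter> (S2 \<union> H) = {}" "card Y2 \<le> q"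
    using S(1) H1(2) card_mono[OF fS(1), of Y2] S(2) by (auto simp: Y2_def)
  note h1 = homogeneous_extension_spread[OF V \<A> \<G>1' \<G>1(2,3) \<tau>1 \<tau>102 H1 r(1,2) spH[OF S(1,2)] Y1 \<H>1_def]
  note h2 = homogeneous_extension_spread[OF V \<A> \<G>2' \<G>2(2,3) \<tau>1 \<tau>102 H2 r(1,2) spH[OF S(3,4)] Y2 \<H>2_def]
  have sub1: "\<H>1 \<subseteq> \<F>" using \<G>1(1) by (auto simp: \<H>1_def containing_def)
  have sub2: "\<H>2 \<subseteq> \<F>" using \<G>2(1) by (auto simp: \<H>2_def containing_def)
  have finA: "finite \<A>" using \<A> V by (rule finite_subset[OF _ finite_imp_finite_nsets])
  have finH: "finite \<H>1" "finite \<H>2" using sub1 sub2 \<F> finA by (meson finite_subset)+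
  have mem: "F - Z \<subseteq> V \<and> card (F - Z) \<le> K" if "F \<in> \<F>" for F Z
  proof -
    have "F \<subseteq> V" "finite F" "card F = k" using that \<F> \<A> by (auto simp: nsets_def)
    then show ?thesis using card_mono[of F "F - Z"] K(2) by auto
  qed
  have R: "2 ^ 13 * ln (real K) \<le> r / 4" using r(3) by simp
  obtain F1 F2 where F: "F1 \<in> \<H>1" "F2 \<in> \<H>2" "(F1 - (S1 \<union> H)) \<inter> (F2 - (S2 \<union> H)) = {}"
  proof (rule spread_disjoint_pair[of V K "r / 4" \<H>1 "\<lambda>F. F - (S1 \<union> H)" \<H>2 "\<lambda>F. F - (S2 \<union> H)",
        OF V K(1) R finH(1) h1(1) _ _ h1(2) finH(2) h2(1) _ _ h2(2)])
    show "F - (S1 \<union> H) \<subseteq> V" "card (F - (S1 \<union> H)) \<le> K" if "F \<in> \<H>1" for F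
      using mem[OF subsetD[OF sub1 that], of "S1 \<union> H"] by auto
    show "F - (S2 \<union> H) \<subseteq> V" "card (F - (S2 \<union> H)) \<le> K" if "F \<in> \<H>2" for F
      using mem[OF subsetD[OF sub2 that], of "S2 \<union> H"] by auto
  qed (use that in auto)
  have "F1 \<inter> F2 = (S1 \<inter> S2) \<union> H"
    using F by (auto simp: \<H>1_def \<H>2_def Y1_def Y2_def containing_def)
  moreover have "card ((S1 \<inter> S2) \<union> H) = t - 1"
    using fS Hl H1(2) lt by (subst card_Un_disjoint) (auto simp: l_def)
  ultimately show False using avoid F sub1 sub2 by (metis subsetD)
qed

section \<open>Combining the approximation with the trivial and nontrivial supports\<close>

theorem theorem10:
  fixes n k t q :: nat and \<epsilon> \<theta> r :: real and \<A> \<F> :: "nat set set"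
  assumes "1 \<le> t" and "t \<le> k" and "k \<le> n"
    and "0 < \<epsilon>" and "\<epsilon> \<le> 0.01"
    and "0 < \<theta>" and "\<theta> \<le> 1"
    and "1 < r" and "t \<le> q"
    and "r \<ge> Max {2 ^ 15 * ln (real k), 2 ^ 17 * real q * ln (real q), real q / (\<epsilon> * \<theta>)}"
    and "\<A> \<subseteq> nsets {1..n} k"
    and "regular_family t q \<epsilon> \<theta> \<A>"
    and "link_spread {1..n} r (2 * q) \<A>"
    and "\<F> \<subseteq> \<A>"
    and "\<forall>F\<in>\<F>. \<forall>F'\<in>\<F>. card (F \<inter> F') \<noteq> t - 1"
  shows "\<exists>T \<in> nsets {1..n} t.
      real (card (\<F> - containing \<A> T)) \<le> exp (- \<epsilon> * \<theta> * real q / real t) * real (card \<A>)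
    \<or> real (card \<F>) \<le> exp (- \<epsilon> * \<theta> * real q / real t) * real (card \<A>)
        + 2 ^ 17 * real q * ln (real q) / r * real (card (link \<A> T))"
proof (cases "k = 1 \<and> q = 1")
  \<comment> \<open>Both logarithmic bounds on \<open>r\<close> vanish here. But
    \<open>t - 1 = 0\<close>, so the singletons in \<open>\<F>\<close> meet pairwise and at most one
    exists.\<close>
  case True
  then have t: "t = 1" using assms(1,2) by simp
  have single: "\<exists>x. F = {x}" "F \<subseteq> {1..n}" if "F \<in> \<F>" for F
    using that assms(11,14) True by (auto simp: nsets_def card_1_singleton_iff)
  show ?thesis
  proof (cases "\<F> = {}")
    case True
    have "{1} \<in> nsets {1..n} t" using t assms(2,3) by (auto simp: nsets_def)
    then show ?thesis using True by (intro bexI[of _ "{1}"]) auto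
  next
    case False
    then obtain T where T: "T \<in> \<F>" by blast
    have "F = T" if "F \<in> \<F>" for F
    proof -
      have "card (F \<inter> T) \<noteq> t - 1" using assms(15) that T by blast
      then have "F \<inter> T \<noteq> {}" using t by auto
      then show ?thesis using single(1)[OF that] single(1)[OF T] by auto
    qed
    then have "\<F> \<subseteq> {T}" by blast
    moreover have "T \<in> containing \<A> T" using T assms(14) by (auto simp: containing_def)
    ultimately have "\<F> - containing \<A> T = {}" by blast
    then have "real (card (\<F> - containing \<A> T)) \<le> exp (- \<epsilon> * \<theta> * real q / real t) * real (card \<A>)"
      by (simp only: card.empty) simp
    moreover have "T \<in> nsets {1..n} t" using T assms(11,14) True t by auto
    ultimately show ?thesis by (intro bexI[of _ T] disjI1)
  qed
next
  case False
  define V where "V = {1..n}"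
  define \<tau> where "\<tau> = exp (\<epsilon> * \<theta> / real t)"
  define K where "K = max k 2"
  let ?e = "exp (- \<epsilon> * \<theta> * real q / real t)"
  have V: "finite V" by (simp add: V_def)
  have \<A>: "\<A> \<subseteq> nsets V k" using assms(11) by (simp add: V_def)
  have finA: "finite \<A>" using \<A> V by (rule finite_subset[OF _ finite_imp_finite_nsets])
  have r0: "0 < r" using assms(8) by simp
  have r: "2 ^ 15 * ln (real k) \<le> r" "2 ^ 17 * real q * ln (real q) \<le> r" "real q / (\<epsilon> * \<theta>) \<le> r"
    using assms(10) by auto
  have "\<epsilon> * \<theta> \<le> 1 / 100 * 1" using assms(4-7) by (intro mult_mono) auto
  then have "100 * real q \<le> real q / (\<epsilon> * \<theta>)"
    using assms(4,6) mult_left_mono[of "\<epsilon> * \<theta>" "1 / 100" "real q"] by (simp add: field_simps)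
  then have rq: "100 * real q \<le> r" using r(3) by linarith
  have ln2: "2 / 3 \<le> ln (real q)" if "2 \<le> q"
  proof -
    have "ln 2 \<le> ln (real q)" using that by (intro ln_mono) auto
    then show ?thesis using ln2_ge_two_thirds by linarith
  qed
  have rK: "2 ^ 15 * ln (real K) \<le> r"
  proof (cases "2 \<le> k")
    case True
    then show ?thesis using r(1) by (simp add: K_def max_def)
  next
    \<comment> \<open>Now \<open>k = 1\<close>, so \<open>q\<close> is at least 2 and the bound with
      \<open>q * ln q\<close> takes over for \<open>K = 2\<close>.\<close>
    case k: False
    then have q2: "2 \<le> q" using False assms(1,2,9) by auto
    then have "ln 2 \<le> ln (real q)" by (intro ln_mono) auto
    then have "2 ^ 15 * 1 * ln 2 \<le> 2 ^ 17 * real q * ln (real q)"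
      using q2 by (intro mult_mono) auto
    then show ?thesis using r(2) k by (simp add: K_def)
  qed
  have \<tau>1: "1 \<le> \<tau>" using assms(4,6) by (simp add: \<tau>_def)
  have \<F>V: "\<F> \<subseteq> Pow V" using assms(14) \<A> by (auto simp: nsets_def)
  obtain \<F>' \<S> where approx: "\<F>' \<subseteq> \<F>" "real (card \<F>') \<le> real (card \<A>) / \<tau> ^ q"
    "\<forall>F\<in>\<F> - \<F>'. \<exists>S\<in>\<S>. S \<subseteq> F"
    "\<forall>S\<in>\<S>. S \<subseteq> V \<and> card S \<le> q \<and> (\<exists>\<G> \<subseteq> containing \<F> S. \<G> \<noteq> {} \<and> homogeneous V \<tau> \<A> S \<G>)"
    using homogeneous_approximation[OF V finA \<tau>1 assms(14) \<F>V, of q] by (elim exE conjE) (rule that)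
  have "real (card \<A>) / \<tau> ^ q = ?e * real (card \<A>)"
  proof -
    have "\<tau> ^ q = exp (\<epsilon> * \<theta> * real q / real t)"
      unfolding \<tau>_def exp_of_nat_mult[symmetric] by (simp add: mult_ac)
    moreover have "?e = inverse (exp (\<epsilon> * \<theta> * real q / real t))"
      unfolding exp_minus[symmetric] by simp
    ultimately show ?thesis by (simp add: divide_inverse mult.commute)
  qed
  then have F': "real (card \<F>') \<le> ?e * real (card \<A>)" using approx(2) by simp
  have int: "t_intersecting t \<S>"
    unfolding t_intersecting_def
  proof (intro ballI)
    fix S1 S2 assume S: "S1 \<in> \<S>" "S2 \<in> \<S>"
    obtain \<G>1 where 1: "S1 \<subseteq> V" "card S1 \<le> q" "\<G>1 \<subseteq> containing \<F> S1" "\<G>1 \<noteq> {}" "homogeneous V \<tau> \<A> S1 \<G>1"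
      using bspec[OF approx(4) S(1)] by (elim conjE exE) (rule that)
    obtain \<G>2 where 2: "S2 \<subseteq> V" "card S2 \<le> q" "\<G>2 \<subseteq> containing \<F> S2" "\<G>2 \<noteq> {}" "homogeneous V \<tau> \<A> S2 \<G>2"
      using bspec[OF approx(4) S(2)] by (elim conjE exE) (rule that)
    show "t \<le> card (S1 \<inter> S2)"
      by (rule homogeneous_supports_intersect[OF V \<A> assms(1,2,9,4-7) r0 rq rK _ _ assms(12) _ _ assms(14)
            \<tau>_def 1(1,2) 2(1,2) 1(3-5) 2(3-5)])
        (use assms(13,15) in \<open>auto simp: K_def V_def\<close>)
  qed
  have finF': "finite \<F>'" using approx(1) assms(14) finA by (meson finite_subset)
  have finF: "finite \<F>" using assms(14) finA by (rule finite_subset)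
  show ?thesis
  proof (cases "nontrivial V t \<S>")
    case False
    then obtain T where T: "T \<in> nsets V t" "\<forall>S\<in>\<S>. T \<subseteq> S" unfolding nontrivial_def by blast
    have "\<F> - containing \<A> T \<subseteq> \<F>'"
    proof
      fix F assume F: "F \<in> \<F> - containing \<A> T"
      show "F \<in> \<F>'"
      proof (rule ccontr)
        assume "F \<notin> \<F>'"
        then obtain S where "S \<in> \<S>" "S \<subseteq> F" using approx(3) F by blast
        then have "T \<subseteq> F" using T(2) by blast
        then show False using F assms(14) by (auto simp: containing_def)
      qed
    qed
    then have "card (\<F> - containing \<A> T) \<le> card \<F>'" using finF' by (rule card_mono[rotated])
    then have "real (card (\<F> - containing \<A> T)) \<le> ?e * real (card \<A>)" using F' by linarith
    then show ?thesis using T(1) unfolding V_def by (intro bexI[of _ T]) auto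
  next
    case nt: True
    have SV: "\<S> \<subseteq> Pow V" using approx(4) by auto
    have neT: "nsets V t \<noteq> {}"
      using nsets_eq_empty_iff[of V t] V assms(2,3) by (auto simp: V_def)
    \<comment> \<open>For \<open>t = q\<close> all supports would have size at most
      \<open>t\<close>, forcing the family to be empty and hence trivial. Thus \<open>q\<close> is
      at least 2 and \<open>ln q\<close> is bounded away from 0.\<close>
    have "t \<noteq> q"
    proof
      assume "t = q"
      then have "\<S> = {}" using nontrivial_card_le_empty[OF V SV int _ nt] approx(4) by simp
      then show False using nt neT unfolding nontrivial_def by blast
    qed
    then have q2: "2 \<le> q" using assms(1,9) by linarith
    \<comment> \<open>A \<open>t\<close>-set of maximal degree serves as \<open>T\<close>;
      spreadness at a \<open>t\<close>-subset of \<open>X\<close> then bounds every larger degree in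
      terms of \<open>m\<close>.\<close>
    define m where "m = Max (deg \<A> ` nsets V t)"
    have fim: "finite (deg \<A> ` nsets V t)" using V finite_imp_finite_nsets by blast
    obtain T where T: "T \<in> nsets V t" "deg \<A> T = m"
    proof -
      have "m \<in> deg \<A> ` nsets V t" unfolding m_def using neT by (intro Max_in[OF fim]) simp
      then show ?thesis using that by auto
    qed
    have deg: "real (deg \<A> X) \<le> real m / r ^ (card X - t)"
      if X: "X \<subseteq> V" "t \<le> card X" for X
    proof -
      obtain U where U: "U \<subseteq> X" "card U = t" "finite U" using obtain_subset_with_card_n[OF X(2)] by metis
      have "real (deg \<A> (U \<union> (X - U))) \<le> real (deg \<A> U) / r ^ card (X - U)"
        using link_spread_deg[OF assms(13) r0, of U "X - U"] U X(1) assms(9) by (auto simp: V_def)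
      moreover have "U \<union> (X - U) = X" "card (X - U) = card X - t" using U by (auto simp: card_Diff_subset)
      moreover have "deg \<A> U \<le> m" unfolding m_def using U X(1) fim by (intro Max_ge) (auto simp: nsets_def)
      then have "real (deg \<A> U) / r ^ (card X - t) \<le> real m / r ^ (card X - t)"
        using r0 by (intro divide_right_mono) auto
      ultimately show ?thesis by simp
    qed
    let ?x = "6 * real q / r"
    let ?U = "\<Union>S\<in>\<S>. containing \<A> S"
    have "real (card ?U) \<le> real m * (real q / r + (\<Sum>d=1..q - t. ?x ^ d))"
      by (rule nontrivial_intersecting_cover_bound[OF V finA r0 _ deg SV int _ nt])
        (use approx(4) assms(9) in auto)
    also have "\<dots> \<le> real m * (2 ^ 17 * real q * ln (real q) / r)"
    proof (rule mult_left_mono)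
      \<comment> \<open>The geometric sum is at most \<open>12 * q / r\<close>. With the term
        \<open>q / r\<close> this gives \<open>13 * q / r\<close>, well below the claimed constant
        because \<open>ln q\<close> is at least 2/3.\<close>
      have x: "0 \<le> ?x" "?x \<le> 1 / 2" using r0 rq by (auto simp: field_simps)
      have "(\<Sum>d=1..j. ?x ^ d) \<le> ?x * (2 - 2 * (1 / 2) ^ j)" for j
      proof (induction j)
        case (Suc j)
        have "?x ^ Suc j \<le> ?x * (1 / 2) ^ j"
          unfolding power_Suc using x by (intro mult_left_mono power_mono)
        then have "(\<Sum>d=1..Suc j. ?x ^ d) \<le> ?x * (2 - 2 * (1 / 2) ^ j) + ?x * (1 / 2) ^ j"
          using Suc by simp
        also have "\<dots> = ?x * (2 - 2 * (1 / 2) ^ Suc j)"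
          unfolding distrib_left[symmetric] by simp
        finally show ?case .
      qed simp
      from this[of "q - t"] have "(\<Sum>d=1..q - t. ?x ^ d) \<le> ?x * 2"
        by (rule order_trans) (use x in \<open>intro mult_left_mono, auto\<close>)
      then have "real q / r + (\<Sum>d=1..q - t. ?x ^ d) \<le> real q / r + ?x * 2" by simp
      also have "\<dots> = real q * 13 / r" by (simp add: add_divide_distrib[symmetric])
      also have "\<dots> \<le> real q * (2 ^ 17 * ln (real q)) / r"
        using ln2[OF q2] r0 by (intro divide_right_mono mult_left_mono) auto
      finally show "real q / r + (\<Sum>d=1..q - t. ?x ^ d) \<le> 2 ^ 17 * real q * ln (real q) / r"
        by (simp add: mult_ac)
    qed simp
    finally have U: "real (card ?U) \<le> 2 ^ 17 * real q * ln (real q) / r * real (card (link \<A> T))"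
      by (simp add: card_link T(2) mult_ac)
    have "\<F> \<subseteq> \<F>' \<union> ?U"
    proof
      fix F assume F: "F \<in> \<F>"
      show "F \<in> \<F>' \<union> ?U"
      proof (cases "F \<in> \<F>'")
        case False
        then obtain S where "S \<in> \<S>" "S \<subseteq> F" using approx(3) F by blast
        then show ?thesis using F assms(14) by (auto simp: containing_def)
      qed simp
    qed
    moreover have "finite ?U" by (rule finite_subset[OF _ finA]) (auto simp: containing_def)
    ultimately have "card \<F> \<le> card (\<F>' \<union> ?U)" using finF' by (intro card_mono) auto
    also have "\<dots> \<le> card \<F>' + card ?U" by (rule card_Un_le)
    finally have "real (card \<F>) \<le> real (card \<F>') + real (card ?U)" by linarith
    then have "real (card \<F>) \<le> ?e * real (card \<A>)
        + 2 ^ 17 * real q * ln (real q) / r * real (card (link \<A> T))"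
      using F' U by linarith
    then show ?thesis using T(1) unfolding V_def by (intro bexI[of _ T]) auto
  qed
qed

end
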